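(* Let $\nu>2$ and let $J_\nu$ be the Bessel function of the first kind of order $\nu$. The function $$z\mapsto 2^{\nu}\Gamma(\nu-2)z^{\frac{5}{2}-\frac{\nu}{2}}J_{\nu}'''(\sqrt{z})$$ is starlike in $\mathbb{D}$ and all of its derivatives are close-to-convex (and hence univalent) in $\mathbb{D}$ if and only if $\nu\geq\nu^{\star}$, where $\nu^{\star}\simeq3.077\dots$ is the unique root on $(2,\infty)$ of the equation (in the unknown $\nu$) $$(2\nu^3-7\nu^2+3)J_{\nu}(1)+(\nu^3+\nu^2+\nu-1)J_{\nu+1}(1)=0.$$
   Context: $\mathbb{D}=\{z\in\mathbb{C}:|z|<1\}$ is the open unit disk. The Bessel function of the first kind is $J_\nu(z)=\sum_{n\ge0}\frac{(-1)^n}{n!\,\Gamma(n+\nu+1)}\left(\frac z2\right)^{2n+\nu}$, and $J_\nu'''$ is its third derivative with respect to $z$; $J_\nu'''(\sqrt z)$ means $J_\nu'''$ evaluated at $\sqrt z$. The displayed function is understood as the entire function of $z$ given by its power series (the fractional powers cancel), which has the form $z+O(z^2)$ at $0$. An analytic function $f$ on $\mathbb{D}$ with $f(0)=0$ is starlike in $\mathbb{D}$ if it is univalent there and $f(\mathbb{D})$ is starlike with respect to the origin. An analytic function $h$ on $\mathbb{D}$ (not necessarily normalized) is close-to-convex in $\mathbb{D}$ if there is a univalent function $\varphi$ on $\mathbb{D}$ with convex image such that $\operatorname{Re}(h'(z)/\varphi'(z))>0$ for all $z\in\mathbb{D}$.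
   Formalization: The unique root of the stated equation on (2,∞) is about 3.0746, so the printed digits 3.077… are wrong; the numerical claim is replaced by |ν* − 3.077| < 0.005, and everything else is as stated. *)

theory Defs
  imports "HOL-Complex_Analysis.Complex_Analysis"
begin

(* All powers are principal branches. Since 0 powr a = 0 for every a, the value at z = 0 is
   the intended one for \<nu> > 0 (but not for \<nu> = 0); only orders \<nu> > 2 are used below. *)
definition bessel_J :: "real \<Rightarrow> complex \<Rightarrow> complex" where
  "bessel_J \<nu> z =
     (\<Sum>n. (- 1) ^ n / (fact n * Gamma (of_nat n + of_real \<nu> + 1))
           * (z / 2) powr (2 * of_nat n + of_real \<nu>))"

(* With principal branches the fractional powers cancel at every complex z, on the negative
   real axis and at z = 0 as well: see normalized_bessel_J3_sums below. *)
definition normalized_bessel_J3 :: "real \<Rightarrow> complex \<Rightarrow> complex" where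
  "normalized_bessel_J3 \<nu> z =
     2 powr of_real \<nu> * Gamma (of_real \<nu> - 2) * z powr (5 / 2 - of_real \<nu> / 2)
       * (deriv ^^ 3) (bessel_J \<nu>) (csqrt z)"

(* The library predicate starlike allows an arbitrary centre; here the centre is the origin. *)
definition starlike_in_disk :: "(complex \<Rightarrow> complex) \<Rightarrow> bool" where
  "starlike_in_disk f \<longleftrightarrow>
     f holomorphic_on ball 0 1 \<and> f 0 = 0 \<and> inj_on f (ball 0 1) \<and>
     (\<forall>w \<in> f ` ball 0 1. closed_segment 0 w \<subseteq> f ` ball 0 1)"

definition close_to_convex_in_disk :: "(complex \<Rightarrow> complex) \<Rightarrow> bool" where
  "close_to_convex_in_disk h \<longleftrightarrow>
     h holomorphic_on ball 0 1 \<and>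
     (\<exists>\<phi>. \<phi> holomorphic_on ball 0 1 \<and> inj_on \<phi> (ball 0 1) \<and> convex (\<phi> ` ball 0 1) \<and>
          (\<forall>z \<in> ball 0 1. Re (deriv h z / deriv \<phi> z) > 0))"

definition bessel_root_eq :: "real \<Rightarrow> bool" where
  "bessel_root_eq \<nu> \<longleftrightarrow>
     of_real (2 * \<nu> ^ 3 - 7 * \<nu> ^ 2 + 3) * bessel_J \<nu> 1
     + of_real (\<nu> ^ 3 + \<nu> ^ 2 + \<nu> - 1) * bessel_J (\<nu> + 1) 1 = 0"

lemma powr_double_nat_add:
  fixes w s :: complex
  assumes "w \<noteq> 0"
  shows "w powr (2 * of_nat n + s) = w powr s * (w ^ 2) ^ n"
proof -
  have "w powr (of_nat (2 * n)) = w ^ (2 * n)"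
    using powr_nat'[of w "2 * n"] assms by (simp del: of_nat_mult)
  thus ?thesis
    using powr_add[of w "of_nat (2 * n)" s] 
    by (simp add: mult_ac flip: power_mult)
qed

lemma deriv_powr_series:
  fixes a :: "nat \<Rightarrow> complex" and s z :: complex
  assumes sm: "\<And>w. summable (\<lambda>n. a n * w ^ n)" and z: "z \<notin> \<real>\<^sub>\<le>\<^sub>0"
  shows "((\<lambda>z. \<Sum>n. a n * (z / 2) powr (2 * of_nat n + s)) has_field_derivative
           (\<Sum>n. (a n * (2 * of_nat n + s) / 2) * (z / 2) powr (2 * of_nat n + (s - 1)))) (at z)"
    and "summable (\<lambda>n. (a n * (2 * of_nat n + s) / 2) * w ^ n)"
proof -
  define A where "A = (\<lambda>w. \<Sum>n. a n * w ^ n)"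
  define A' where "A' = (\<lambda>w. \<Sum>n. diffs a n * w ^ n)"
  have A': "(A has_field_derivative A' w) (at w)" for w
    unfolding A_def A'_def by (rule termdiffs_strong_converges_everywhere) (rule sm)
  have sd: "summable (\<lambda>n. diffs a n * w ^ n)" for w
    by (rule termdiff_converges_all) (rule sm)
  have s1: "(\<lambda>n. of_nat n * a n * w ^ n) sums (w * A' w)" for w
  proof -
    have "(\<lambda>n. diffs a n * w ^ n * w) sums (A' w * w)"
      unfolding A'_def by (intro sums_mult2 summable_sums sd)
    hence "(\<lambda>n. of_nat (Suc n) * a (Suc n) * w ^ Suc n) sums (A' w * w)"
      by (simp add: diffs_def mult_ac)
    from sums_Suc[OF this] show ?thesis by (simp add: mult_ac)
  qed
  have s2: "(\<lambda>n. (a n * (2 * of_nat n + s) / 2) * w ^ n) sums (w * A' w + s / 2 * A w)" for w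
    using sums_add[OF s1 sums_mult[OF summable_sums[OF sm], of "s / 2"], of w w]
    by (simp add: A_def field_simps)
  thus "summable (\<lambda>n. (a n * (2 * of_nat n + s) / 2) * w ^ n)"
    by (rule sums_summable)
  have ser: "(\<Sum>n. b n * (y / 2) powr (2 * of_nat n + t)) = (y / 2) powr t * (\<Sum>n. b n * ((y / 2) ^ 2) ^ n)"
    if "y \<noteq> 0" "\<And>w. summable (\<lambda>n. b n * w ^ n)" for b :: "nat \<Rightarrow> complex" and y t :: complex
    using that suminf_mult[OF that(2)[of "(y / 2) ^ 2"], of "(y / 2) powr t"]
    by (simp add: powr_double_nat_add mult.left_commute)
  have z0: "z \<noteq> 0" and z2: "z / 2 \<notin> \<real>\<^sub>\<le>\<^sub>0"
    using z by (auto simp: complex_nonpos_Reals_iff)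
  have "((\<lambda>y. (y / 2) powr s * A ((y / 2) ^ 2)) has_field_derivative
          (z / 2) powr (s - 1) * ((z / 2) ^ 2 * A' ((z / 2) ^ 2) + s / 2 * A ((z / 2) ^ 2))) (at z)"
  proof -
    have p: "(z / 2) powr s = (z / 2) powr (s - 1) * (z / 2)"
      using powr_add[of "z / 2" "s - 1" 1] z0 by simp
    have "((\<lambda>y. (y / 2) powr s) has_field_derivative s * (z / 2) powr (s - 1) * (1 / 2)) (at z)"
      by (rule DERIV_chain2[where f = "\<lambda>w. w powr s" and g = "\<lambda>y. y / 2", OF has_field_derivative_powr[OF z2]])
         (auto intro!: derivative_eq_intros)
    moreover have "((\<lambda>y. A ((y / 2) ^ 2)) has_field_derivative A' ((z / 2) ^ 2) * (z / 2)) (at z)"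
      by (rule DERIV_chain2[OF A']) (auto intro!: derivative_eq_intros)
    ultimately show ?thesis
      by (rule DERIV_cong[OF DERIV_mult]) (simp add: p algebra_simps power2_eq_square)
  qed
  moreover have "(\<Sum>n. (a n * (2 * of_nat n + s) / 2) * (z / 2) powr (2 * of_nat n + (s - 1))) =
      (z / 2) powr (s - 1) * ((z / 2) ^ 2 * A' ((z / 2) ^ 2) + s / 2 * A ((z / 2) ^ 2))"
    using ser[OF z0 sums_summable[OF s2], of "s - 1"] sums_unique[OF s2] by simp
  ultimately have "((\<lambda>y. (y / 2) powr s * A ((y / 2) ^ 2)) has_field_derivative
      (\<Sum>n. (a n * (2 * of_nat n + s) / 2) * (z / 2) powr (2 * of_nat n + (s - 1)))) (at z)"
    by simp
  thus "((\<lambda>z. \<Sum>n. a n * (z / 2) powr (2 * of_nat n + s)) has_field_derivative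
      (\<Sum>n. (a n * (2 * of_nat n + s) / 2) * (z / 2) powr (2 * of_nat n + (s - 1)))) (at z)"
    by (rule DERIV_cong_ev[THEN iffD1, rotated 3])
      (use z0 ser[OF _ sm] in \<open>auto simp: A_def intro!: eventually_mono[OF t1_space_nhds[OF z0]]\<close>)
qed

lemma norm_inverse_Gamma_le:
  fixes \<nu> :: real
  assumes "\<nu> > 0"
  shows "norm (1 / Gamma (of_nat n + of_real \<nu> + 1 :: complex)) \<le> 1 / Gamma (\<nu> + 1)"
proof -
  have g: "Gamma (real n + \<nu> + 1) \<ge> Gamma (\<nu> + 1)"
  proof (induction n)
    case (Suc n)
    have "Gamma (real (Suc n) + \<nu> + 1) = (real n + \<nu> + 1) * Gamma (real n + \<nu> + 1)"
      using Gamma_plus1[of "real n + \<nu> + 1"] assms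
      by (auto simp: add_ac nonpos_Ints_def)
    moreover have "Gamma (real n + \<nu> + 1) > 0"
      using assms by (intro Gamma_real_pos) auto
    ultimately show ?case
      using Suc assms mult_right_mono[of 1 "real n + \<nu> + 1" "Gamma (real n + \<nu> + 1)"] by linarith
  qed simp
  have "Gamma (of_nat n + of_real \<nu> + 1 :: complex) = of_real (Gamma (real n + \<nu> + 1))"
    by (simp flip: Gamma_complex_of_real)
  moreover have "Gamma (\<nu> + 1) > 0" using assms by (intro Gamma_real_pos) auto
  ultimately show ?thesis using g by (simp add: norm_divide frac_le)
qed

lemma summable_bessel_coeff:
  fixes \<nu> :: real and w :: complex
  assumes "\<nu> > 0"
  shows "summable (\<lambda>n. (- 1) ^ n / (fact n * Gamma (of_nat n + of_real \<nu> + 1)) * w ^ n)"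
proof (rule summable_comparison_test')
  show "summable (\<lambda>n. 1 / Gamma (\<nu> + 1) * (norm w ^ n / fact n))"
    using summable_exp[of "norm w"] by (intro summable_mult) (simp add: divide_inverse mult.commute)
  show "norm ((- 1) ^ n / (fact n * Gamma (of_nat n + of_real \<nu> + 1)) * w ^ n)
      \<le> 1 / Gamma (\<nu> + 1) * (norm w ^ n / fact n)" for n
    using mult_right_mono[OF norm_inverse_Gamma_le[OF assms, of n], of "norm w ^ n / fact n"]
    by (simp add: norm_mult norm_divide norm_power mult_ac)
qed

lemma normalized_bessel_J3_sums:
  fixes \<nu> :: real and z :: complex
  assumes "\<nu> > 2"
  shows "(\<lambda>n. (- 1) ^ n * Gamma (of_real \<nu> - 2)
            * ((2 * of_nat n + of_real \<nu>) * (2 * of_nat n + of_real \<nu> - 1) * (2 * of_nat n + of_real \<nu> - 2))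
            / (fact n * Gamma (of_nat n + of_real \<nu> + 1) * 4 ^ n) * z ^ Suc n)
         sums normalized_bessel_J3 \<nu> z"
proof (cases "z = 0")
  case True
  thus ?thesis by (simp add: normalized_bessel_J3_def)
next
  case False
  define v where "v = complex_of_real \<nu>"
  define a where "a = (\<lambda>n. (- 1) ^ n / (fact n * Gamma (of_nat n + v + 1)) :: complex)"
  define b where "b = (\<lambda>n. a n * (2 * of_nat n + v) / 2)"
  define c where "c = (\<lambda>n. b n * (2 * of_nat n + (v - 1)) / 2)"
  define d where "d = (\<lambda>n. c n * (2 * of_nat n + (v - 1 - 1)) / 2)"
  define G where "G = (\<lambda>(f :: nat \<Rightarrow> complex) s z. \<Sum>n. f n * (z / 2) powr (2 * of_nat n + s))"
  have sa: "summable (\<lambda>n. a n * w ^ n)" for w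
    using summable_bessel_coeff[of \<nu> w] assms by (simp add: a_def v_def)
  have sb: "summable (\<lambda>n. b n * w ^ n)" for w
    unfolding b_def by (rule deriv_powr_series(2)[of a 1 v w, OF sa]) simp
  have sc: "summable (\<lambda>n. c n * w ^ n)" for w
    unfolding c_def by (rule deriv_powr_series(2)[of b 1 "v - 1" w, OF sb]) simp
  have sd: "summable (\<lambda>n. d n * w ^ n)" for w
    unfolding d_def by (rule deriv_powr_series(2)[of c 1 "v - 1 - 1" w, OF sc]) simp
  have slit: "\<forall>\<^sub>F y in nhds x. y \<notin> \<real>\<^sub>\<le>\<^sub>0" if "x \<notin> \<real>\<^sub>\<le>\<^sub>0" for x :: complex
    using that eventually_nhds_in_open[of "- \<real>\<^sub>\<le>\<^sub>0" x] by (simp add: open_Compl)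
  have J: "bessel_J \<nu> = G a v"
    by (simp add: fun_eq_iff bessel_J_def G_def a_def v_def)
  have d1: "deriv (G a v) x = G b (v - 1) x" if "x \<notin> \<real>\<^sub>\<le>\<^sub>0" for x
    unfolding G_def b_def by (rule DERIV_imp_deriv) (rule deriv_powr_series(1)[OF sa that])
  have d2: "deriv (G b (v - 1)) x = G c (v - 1 - 1) x" if "x \<notin> \<real>\<^sub>\<le>\<^sub>0" for x
    unfolding G_def c_def by (rule DERIV_imp_deriv) (rule deriv_powr_series(1)[OF sb that])
  have d3: "deriv (G c (v - 1 - 1)) x = G d (v - 1 - 1 - 1) x" if "x \<notin> \<real>\<^sub>\<le>\<^sub>0" for x
    unfolding G_def d_def by (rule DERIV_imp_deriv) (rule deriv_powr_series(1)[OF sc that])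
  have d12: "deriv (deriv (G a v)) x = G c (v - 1 - 1) x" if "x \<notin> \<real>\<^sub>\<le>\<^sub>0" for x
    using deriv_cong_ev[OF eventually_mono[OF slit[OF that] d1] refl] d2[OF that] by simp
  have d123: "deriv (deriv (deriv (G a v))) x = G d (v - 1 - 1 - 1) x" if "x \<notin> \<real>\<^sub>\<le>\<^sub>0" for x
    using deriv_cong_ev[OF eventually_mono[OF slit[OF that] d12] refl] d3[OF that] by simp
  define r where "r = csqrt z"
  have r0: "r \<noteq> 0" and rz: "r ^ 2 = z" using False by (auto simp: r_def)
  have rs: "r \<notin> \<real>\<^sub>\<le>\<^sub>0"
    using csqrt_principal[of z] r0 by (auto simp: r_def complex_nonpos_Reals_iff complex_eq_iff)
  have lnz: "Ln z = 2 * Ln r"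
  proof -
    have "r = exp (Ln z / 2)" using csqrt_exp_Ln[OF False] by (simp add: r_def)
    moreover have "Ln (exp (Ln z / 2)) = Ln z / 2"
      using mpi_less_Im_Ln[OF False] Im_Ln_le_pi[OF False] pi_gt_zero by (intro Ln_exp) (simp, simp)
    ultimately have "Ln r = Ln z / 2" by metis
    thus ?thesis by (simp add: field_simps)
  qed
  have p1: "z powr (5 / 2 - v / 2) = r powr (5 - v)"
    using False r0 by (simp add: powr_def lnz algebra_simps)
  have p2: "(r / 2) powr (v - 3) = r powr (v - 3) / 2 powr (v - 3)"
  proof -
    have "Ln (r / 2) = Ln r - Ln 2"
      using Ln_divide_of_real[of 2 r] r0 by (simp add: Ln_of_real[of 2, simplified])
    thus ?thesis using r0 by (simp add: powr_def right_diff_distrib exp_diff)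
  qed
  have p3: "r powr (5 - v) * r powr (v - 3) = z"
    using powr_add[of r "5 - v" "v - 3"] r0 rz powr_nat'[of r 2] by simp
  have p4: "2 powr v = 2 powr (v - 3) * 8"
    using powr_add[of 2 "v - 3" 3] powr_nat'[of 2 3] by simp
  have "(\<lambda>n. d n * (r / 2) powr (2 * of_nat n + (v - 3))) sums G d (v - 3) r"
  proof -
    have "summable (\<lambda>n. (r / 2) powr (v - 3) * (d n * ((r / 2) ^ 2) ^ n))"
      by (intro summable_mult sd)
    hence "summable (\<lambda>n. d n * (r / 2) powr (2 * of_nat n + (v - 3)))"
      using r0 by (simp add: powr_double_nat_add mult.left_commute)
    thus ?thesis by (simp add: G_def summable_sums)
  qed
  hence "(\<lambda>n. 2 powr v * Gamma (v - 2) * z powr (5 / 2 - v / 2)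
             * (d n * (r / 2) powr (2 * of_nat n + (v - 3)))) sums normalized_bessel_J3 \<nu> z"
    using d123[OF rs]
    by (simp add: normalized_bessel_J3_def J v_def r_def numeral_3_eq_3 sums_mult
        del: csqrt.simps)
  moreover have "2 powr v * Gamma (v - 2) * z powr (5 / 2 - v / 2)
             * (d n * (r / 2) powr (2 * of_nat n + (v - 3)))
           = (- 1) ^ n * Gamma (v - 2)
            * ((2 * of_nat n + v) * (2 * of_nat n + v - 1) * (2 * of_nat n + v - 2))
            / (fact n * Gamma (of_nat n + v + 1) * 4 ^ n) * z ^ Suc n" for n
  proof -
    have "z powr (5 / 2 - v / 2) * (r / 2) powr (2 * of_nat n + (v - 3))
        = (r powr (5 - v) * r powr (v - 3)) * (z / 4) ^ n / 2 powr (v - 3)"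
      using r0 rz
      apply (simp add: powr_double_nat_add p1 p2 power_divide)
      apply (simp add: mult_ac)
      done
    also have "\<dots> = z ^ Suc n / 4 ^ n / 2 powr (v - 3)"
      by (simp add: p3 power_divide)
    finally have q: "z powr (5 / 2 - v / 2) * (r / 2) powr (2 * of_nat n + (v - 3))
        = z ^ Suc n / 4 ^ n / 2 powr (v - 3)" .
    have "2 powr v * Gamma (v - 2) * z powr (5 / 2 - v / 2)
             * (d n * (r / 2) powr (2 * of_nat n + (v - 3)))
        = 2 powr v * Gamma (v - 2) * d n * (z ^ Suc n / 4 ^ n / 2 powr (v - 3))"
      unfolding q[symmetric] by (simp only: mult_ac)
    also have "\<dots> = 8 * Gamma (v - 2) * d n * (z ^ Suc n / 4 ^ n)"
      by (simp add: p4)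
    also have "\<dots> = (- 1) ^ n * Gamma (v - 2)
            * ((2 * of_nat n + v) * (2 * of_nat n + v - 1) * (2 * of_nat n + v - 2))
            / (fact n * Gamma (of_nat n + v + 1) * 4 ^ n) * z ^ Suc n"
      by (simp add: d_def c_def b_def a_def mult_ac diff_diff_eq add_diff_eq)
    finally show ?thesis .
  qed
  ultimately show ?thesis by (simp add: v_def)
qed

end

theory Submission
  imports Defs
begin

text \<open>
  Write \<open>f(z) = z (1 - c\<^sub>1 z + c\<^sub>2 z\<^sup>2 - \<dots>)\<close> for the normalized function of order \<open>\<nu>\<close>; all
  \<open>c\<^sub>n\<close> are positive.  Everything is governed by the sign of \<open>f'(1) = 1 - 2 c\<^sub>1 + 3 c\<^sub>2 - \<dots>\<close>.

  Necessity.  If \<open>f\<close> is univalent, then \<open>f'\<close> has no zero on \<open>[0,1)\<close>, where it is real and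
  starts at \<open>1\<close>, so \<open>f'(1) \<ge> 0\<close> (\<open>inj_on_disk_imp_deriv_at_one_nonneg\<close>).

  Sufficiency.  For \<open>\<nu> \<ge> 3\<close> the \<open>c\<^sub>n\<close> with \<open>n \<ge> 2\<close> are small compared with \<open>c\<^sub>1\<close>.  Hence,
  up to a small error, both \<open>f'(z) - f'(1)\<close> and \<open>f(z)/z - f(1)\<close> are positive multiples of
  \<open>1 - z\<close>, namely \<open>2 c\<^sub>1 (1 - z)\<close> and \<open>c\<^sub>1 (1 - z)\<close>; the errors are bounded by multiples of
  \<open>\<bar>1 - z\<bar>\<close>, and their real parts by multiples of \<open>Re (1 - z)\<close>, so that nothing is lost at the
  critical boundary point \<open>1\<close>.  With \<open>f'(1) \<ge> 0\<close> this makes \<open>Re f'\<close> and \<open>Re (z f'/f)\<close>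
  positive in the disk (\<open>starlike_in_disk_power_series\<close>); the first gives univalence and the
  second starlikeness.  From the second derivative on, the coefficients of \<open>f\<^sup>(\<^sup>j\<^sup>)\<close> decay
  geometrically with ratio below \<open>1/2\<close>, so that \<open>f\<^sup>(\<^sup>j\<^sup>) / f\<^sup>(\<^sup>j\<^sup>)(0)\<close> has positive real part and
  \<open>f\<^sup>(\<^sup>j\<^sup>-\<^sup>1\<^sup>)\<close> is close-to-convex with respect to a linear map
  (\<open>close_to_convex_deriv_normalized_bessel_J3\<close>).

  The critical order.  Up to the factor \<open>(\<nu> - 1) (\<nu> - 2)\<close>, the number \<open>f'(1)\<close> is the function
  \<open>J3_slope\<close>.  A telescoping identity for the Bessel weights identifies it with a positive multiple
  of the left-hand side of the given equation (\<open>bessel_root_eq_iff_slope\<close>).  Its leading part is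
  \<open>(\<nu> - 1) (\<nu> - 2) - (\<nu> + 2)/2\<close>, which increases with slope at least \<open>1/2\<close> on \<open>[2,\<infinity>)\<close>,
  and the remaining terms vary too little to destroy this (\<open>J3_slope_strict_mono\<close>).  So there is
  exactly one root, and rational bounds at \<open>3.072\<close> and \<open>3.082\<close> locate it.
\<close>

section \<open>Univalence and starlikeness from positive real parts\<close>

text \<open>
  The Noshiro--Warschawski criterion.  If \<open>h\<close> took the same value at \<open>a \<noteq> b\<close>, then
  \<open>Re (h / (b - a))\<close> would have equal values at both ends of the segment from \<open>a\<close> to \<open>b\<close>, but its
  derivative along the segment is \<open>Re h' > 0\<close>.
\<close>
lemma Re_deriv_pos_imp_inj_on:
  fixes h :: "complex \<Rightarrow> complex"
  assumes "open S" "convex S" and hol: "h holomorphic_on S"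
    and pos: "\<And>z. z \<in> S \<Longrightarrow> Re (deriv h z) > 0"
  shows "inj_on h S"
proof (rule inj_onI, rule ccontr)
  fix a b assume a: "a \<in> S" and b: "b \<in> S" and eq: "h a = h b" and "a \<noteq> b"
  define p where "p = (\<lambda>t. a + of_real t * (b - a))"
  define g where "g = (\<lambda>t. Re (h (p t) / (b - a)))"
  have "\<exists>y. (g has_real_derivative y) (at t) \<and> y > 0" if "0 \<le> t" "t \<le> 1" for t
  proof -
    have pS: "p t \<in> S"
    proof -
      have "p t = (1 - t) *\<^sub>R a + t *\<^sub>R b"
        by (simp add: p_def scaleR_conv_of_real algebra_simps)
      thus ?thesis using convexD_alt[OF \<open>convex S\<close> a b that] by simp
    qed
    have "(p has_vector_derivative (b - a)) (at t)"
      unfolding p_def by (rule derivative_eq_intros refl | simp)+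
    hence "((h \<circ> p) has_vector_derivative (b - a) * deriv h (p t)) (at t)"
      by (rule field_vector_diff_chain_at) (rule holomorphic_derivI[OF hol \<open>open S\<close> pS])
    hence "((\<lambda>t. (h \<circ> p) t / (b - a)) has_vector_derivative (b - a) * deriv h (p t) / (b - a)) (at t)"
      by (intro has_vector_derivative_divide)
    moreover have "(b - a) * deriv h (p t) / (b - a) = deriv h (p t)" using \<open>a \<noteq> b\<close> by simp
    ultimately have "((\<lambda>t. h (p t) / (b - a)) has_vector_derivative deriv h (p t)) (at t)"
      by (simp only: o_def)
    hence "(g has_vector_derivative Re (deriv h (p t))) (at t)"
      unfolding g_def by (rule bounded_linear.has_vector_derivative[OF bounded_linear_Re])
    hence "(g has_real_derivative Re (deriv h (p t))) (at t)"
      by (simp only: has_real_derivative_iff_has_vector_derivative)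
    thus ?thesis using pos[OF pS] by blast
  qed
  hence "g 0 < g 1" by (rule DERIV_pos_imp_increasing[OF zero_less_one])
  thus False using eq by (simp add: g_def p_def)
qed

text \<open>
  Kaplan's argument: \<open>h \<circ> \<phi>\<inverse>\<close> lives on the convex image of \<open>\<phi>\<close> and has derivative \<open>h' / \<phi>'\<close>,
  so the previous criterion applies to it.
\<close>
lemma close_to_convex_imp_inj_on:
  assumes "close_to_convex_in_disk h"
  shows "inj_on h (ball 0 1)"
proof -
  obtain \<phi> where h: "h holomorphic_on ball 0 1" and \<phi>: "\<phi> holomorphic_on ball 0 1"
      "inj_on \<phi> (ball 0 1)" "convex (\<phi> ` ball 0 1)"
    and pos: "\<And>z. z \<in> ball 0 1 \<Longrightarrow> Re (deriv h z / deriv \<phi> z) > 0"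
    using assms unfolding close_to_convex_in_disk_def by auto
  obtain \<psi> where \<psi>: "\<psi> holomorphic_on \<phi> ` ball 0 1"
      "\<And>z. z \<in> ball 0 1 \<Longrightarrow> deriv \<phi> z * deriv \<psi> (\<phi> z) = 1" "\<And>z. z \<in> ball 0 1 \<Longrightarrow> \<psi> (\<phi> z) = z"
    using holomorphic_has_inverse[OF \<phi>(1) open_ball \<phi>(2)] by metis
  have op: "open (\<phi> ` ball 0 1)"
    using open_mapping_thm3[OF \<phi>(1) open_ball \<phi>(2)] .
  have "inj_on (h \<circ> \<psi>) (\<phi> ` ball 0 1)"
  proof (rule Re_deriv_pos_imp_inj_on[OF op \<phi>(3)])
    show "(h \<circ> \<psi>) holomorphic_on \<phi> ` ball 0 1"
      by (rule holomorphic_on_compose_gen[OF \<psi>(1) h]) (use \<psi>(3) in auto)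
    fix w assume "w \<in> \<phi> ` ball 0 1"
    then obtain z where z: "z \<in> ball 0 1" and w: "w = \<phi> z" by blast
    have "(\<psi> has_field_derivative deriv \<psi> w) (at w)"
      using holomorphic_derivI[OF \<psi>(1) op] z w by blast
    moreover have "(h has_field_derivative deriv h z) (at (\<psi> w))"
      using holomorphic_derivI[OF h open_ball z] \<psi>(3)[OF z] w by simp
    ultimately have "deriv (h \<circ> \<psi>) w = deriv h z * deriv \<psi> w"
      by (intro DERIV_imp_deriv DERIV_chain)
    moreover have "deriv \<psi> w = 1 / deriv \<phi> z"
      using \<psi>(2)[OF z] w by (auto simp: eq_divide_eq mult.commute)
    ultimately show "Re (deriv (h \<circ> \<psi>) w) > 0" using pos[OF z] by simp
  qed
  hence "inj_on h (\<psi> ` \<phi> ` ball 0 1)" by (rule inj_on_imageI)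
  moreover have "\<psi> ` \<phi> ` ball 0 1 = ball 0 1" using \<psi>(3) by force
  ultimately show ?thesis by simp
qed

text \<open>
  The reason is that the preimage \<open>z(t)\<close> of \<open>t w\<close> satisfies
  \<open>d/dt \<bar>z\<bar>\<^sup>2 = 2 \<bar>z\<bar>\<^sup>2 Re (f / (z f')) / t > 0\<close>: as the point \<open>t w\<close> retreats to the origin, its
  preimage moves inwards and therefore cannot leave the closed disk in which it started.
\<close>
lemma starlike_in_diskI:
  assumes hol: "f holomorphic_on ball 0 1" and f0: "f 0 = 0" and inj: "inj_on f (ball 0 1)"
    and pos: "\<And>z. z \<in> ball 0 1 \<Longrightarrow> z \<noteq> 0 \<Longrightarrow> Re (z * deriv f z / f z) > 0"
  shows "starlike_in_disk f"
  unfolding starlike_in_disk_def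
proof (intro conjI ballI hol f0 inj)
  fix w assume "w \<in> f ` ball 0 1"
  then obtain z0 where z0: "norm z0 < 1" and w: "w = f z0" by auto
  obtain g where g: "g holomorphic_on f ` ball 0 1"
      "\<And>z. z \<in> ball 0 1 \<Longrightarrow> deriv f z * deriv g (f z) = 1" "\<And>z. z \<in> ball 0 1 \<Longrightarrow> g (f z) = z"
    using holomorphic_has_inverse[OF hol open_ball inj] by metis
  have op: "open (f ` ball 0 1)" using open_mapping_thm3[OF hol open_ball inj] .
  define K where "K = f ` cball 0 (norm z0)"
  have sub: "cball 0 (norm z0) \<subseteq> ball (0::complex) 1" using z0 by auto
  have "compact K" unfolding K_def
    by (intro compact_continuous_image compact_cball
          continuous_on_subset[OF holomorphic_on_imp_continuous_on[OF hol] sub])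
  hence "closed K" by (rule compact_imp_closed)
  define A where "A = {t \<in> {0..1::real}. of_real t * w \<in> K}"
  have "closed ((\<lambda>t. of_real t * w) -` K \<inter> {0..1::real})"
    by (intro continuous_closed_preimage continuous_intros) (use \<open>closed K\<close> in auto)
  hence clA: "closed (A \<inter> {s..})" for s
    by (intro closed_Int) (auto simp: A_def Int_def conj_commute vimage_def)
  have "t \<in> A" if t: "t \<in> {0..1}" for t
  proof (rule ccontr)
    assume nt: "t \<notin> A"
    \<comment> \<open>the smallest parameter above \<open>t\<close> whose preimage lies in the closed disk;
      the retreat from there yields a smaller one, which is a contradiction\<close>
    define t1 where "t1 = Inf (A \<inter> {t..})"
    have one: "1 \<in> A \<inter> {t..}" using t w by (auto simp: A_def K_def)
    have bdd: "bdd_below (A \<inter> {t..})" by (rule bdd_belowI[of _ t]) auto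
    have t1: "t1 \<in> A \<inter> {t..}" unfolding t1_def
      using closed_contains_Inf[OF _ bdd clA] one by blast
    hence "t < t1" using nt by (cases "t = t1") auto
    hence t1pos: "t1 > 0" using t by auto
    obtain z1 where z1: "norm z1 \<le> norm z0" "of_real t1 * w = f z1"
      using t1 by (auto simp: A_def K_def)
    have z1b: "z1 \<in> ball 0 1" using z1 z0 by simp
    have w0: "w \<noteq> 0"
    proof
      assume "w = 0"
      hence "t \<in> A" using t f0 by (auto simp: A_def K_def intro!: image_eqI[of _ _ 0])
      thus False using nt by blast
    qed
    hence "f z1 \<noteq> 0" using z1(2)[symmetric] t1pos by simp
    hence z1n: "z1 \<noteq> 0" using f0 by auto
    have d0: "deriv f z1 \<noteq> 0" using g(2)[OF z1b] by auto
    have "deriv g (f z1) = 1 / deriv f z1"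
      using g(2)[OF z1b] d0 by (simp add: eq_divide_eq mult.commute)
    hence "(g has_field_derivative 1 / deriv f z1) (at (f z1))"
      using holomorphic_derivI[OF g(1) op, of "f z1"] z1b by auto
    hence "(g has_field_derivative 1 / deriv f z1) (at (of_real t1 * w))" using z1 by simp
    moreover have "((\<lambda>t. of_real t * w) has_vector_derivative w) (at t1)"
      by (auto intro!: derivative_eq_intros)
    ultimately have dg: "((g \<circ> (\<lambda>t. of_real t * w)) has_vector_derivative w * (1 / deriv f z1)) (at t1)"
      by (intro field_vector_diff_chain_at) auto
    define \<gamma> where "\<gamma> = (\<lambda>t. g (of_real t * w))"
    define D where "D = w / deriv f z1"
    have gt1: "\<gamma> t1 = z1" using z1 g(3)[OF z1b] by (simp add: \<gamma>_def)
    have d\<gamma>: "(\<gamma> has_vector_derivative D) (at t1)" using dg by (simp add: \<gamma>_def D_def o_def)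
    have "((\<lambda>t. \<gamma> t \<bullet> \<gamma> t) has_real_derivative 2 * (z1 \<bullet> D)) (at t1)"
      using bounded_bilinear.has_vector_derivative[OF bounded_bilinear_inner d\<gamma> d\<gamma>] gt1
      by (simp add: has_real_derivative_iff_has_vector_derivative inner_commute)
    moreover have "z1 \<bullet> D > 0"
    proof -
      define u where "u = z1 * deriv f z1 / f z1"
      have "Re u > 0" using pos[OF z1b z1n] by (simp add: u_def)
      hence un: "u \<noteq> 0" by auto
      have "D = z1 / (of_real t1 * u)"
        using z1(2)[symmetric] t1pos d0 z1n w0 by (simp add: D_def u_def)
      moreover have "z1 \<bullet> D = Re (cnj z1 * D)" by (simp add: inner_complex_def)
      moreover have "cnj z1 * z1 = of_real ((norm z1)\<^sup>2)"
        by (metis complex_norm_square mult.commute)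
      ultimately have "z1 \<bullet> D = Re (of_real ((norm z1)\<^sup>2 / t1) * (1 / u))" by simp
      also have "\<dots> = (norm z1)\<^sup>2 / t1 * Re (1 / u)" by (metis scaleR_conv_of_real scaleR_complex.sel(1))
      also have "Re (1 / u) = Re u / (norm u)\<^sup>2"
        by (simp add: Re_divide cmod_power2)
      finally show ?thesis using \<open>Re u > 0\<close> un t1pos z1n by simp
    qed
    ultimately obtain d where d: "d > 0" "\<And>h. 0 < h \<Longrightarrow> h < d \<Longrightarrow> \<gamma> (t1 - h) \<bullet> \<gamma> (t1 - h) < \<gamma> t1 \<bullet> \<gamma> t1"
      using DERIV_pos_inc_left[of "\<lambda>t. \<gamma> t \<bullet> \<gamma> t" "2 * (z1 \<bullet> D)" t1] by auto
    have "((\<lambda>t. of_real t * w) \<longlongrightarrow> of_real t1 * w) (at t1)" by (intro tendsto_intros)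
    moreover have "of_real t1 * w \<in> f ` ball 0 1" using z1 z1b by auto
    ultimately have "eventually (\<lambda>t. of_real t * w \<in> f ` ball 0 1) (at t1)"
      using op topological_tendstoD by blast
    then obtain e where e: "e > 0" "\<And>s. s \<noteq> t1 \<Longrightarrow> dist s t1 < e \<Longrightarrow> of_real s * w \<in> f ` ball 0 1"
      unfolding eventually_at by auto
    define h where "h = min (min d e) (t1 - t) / 2"
    have h: "0 < h" "h < d" "h < e" "h < t1 - t" using d(1) e(1) \<open>t < t1\<close> by (auto simp: h_def)
    obtain z2 where z2: "z2 \<in> ball 0 1" "of_real (t1 - h) * w = f z2"
      using e(2)[of "t1 - h"] h by (auto simp: dist_real_def)
    have "\<gamma> (t1 - h) = z2" using z2 g(3) by (simp add: \<gamma>_def)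
    hence "norm z2 < norm z1" using d(2)[OF h(1,2)] gt1 by (simp add: norm_lt)
    hence "of_real (t1 - h) * w \<in> K" using z1 z2 by (auto simp: K_def intro!: imageI)
    moreover have "t1 - h \<in> {0..1}" "t \<le> t1 - h" using h t t1 by (auto simp: A_def)
    ultimately have "t1 - h \<in> A \<inter> {t..}" by (auto simp: A_def)
    hence "t1 \<le> t1 - h" unfolding t1_def by (rule cInf_lower) (rule bdd)
    thus False using h by simp
  qed
  hence "of_real t * w \<in> f ` ball 0 1" if "t \<in> {0..1}" for t
    using that sub by (fastforce simp: A_def K_def)
  thus "closed_segment 0 w \<subseteq> f ` ball 0 1"
    by (auto simp: in_segment scaleR_conv_of_real)
qed

section \<open>Power series dominated by their first coefficients\<close>

lemma higher_deriv_power_series: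
  fixes b :: "nat \<Rightarrow> complex"
  assumes sm: "\<And>y. summable (\<lambda>n. b n * y ^ n)"
  shows "summable (\<lambda>n. (diffs ^^ j) b n * y ^ n)"
    and "(deriv ^^ j) (\<lambda>z. \<Sum>n. b n * z ^ n) = (\<lambda>z. \<Sum>n. (diffs ^^ j) b n * z ^ n)"
proof -
  have S: "summable (\<lambda>n. (diffs ^^ j) b n * y ^ n)" for j y
  proof (induction j arbitrary: y)
    case (Suc j)
    show ?case unfolding funpow.simps o_def by (rule termdiff_converges_all) (rule Suc)
  qed (simp add: sm)
  thus "summable (\<lambda>n. (diffs ^^ j) b n * y ^ n)" .
  show "(deriv ^^ j) (\<lambda>z. \<Sum>n. b n * z ^ n) = (\<lambda>z. \<Sum>n. (diffs ^^ j) b n * z ^ n)"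
  proof (induction j)
    case (Suc j)
    have "deriv (\<lambda>z. \<Sum>n. (diffs ^^ j) b n * z ^ n) z = (\<Sum>n. (diffs ^^ Suc j) b n * z ^ n)" for z
      unfolding funpow.simps o_def
      by (rule DERIV_imp_deriv) (rule termdiffs_strong_converges_everywhere[OF S])
    hence "deriv (\<lambda>z. \<Sum>n. (diffs ^^ j) b n * z ^ n) = (\<lambda>z. \<Sum>n. (diffs ^^ Suc j) b n * z ^ n)"
      by (rule ext)
    with Suc show ?case by (simp only: funpow.simps o_def)
  qed simp
qed

lemma diffs_funpow:
  fixes b :: "nat \<Rightarrow> complex"
  shows "(diffs ^^ j) b n = fact (n + j) / fact n * b (n + j)"
proof (induction j arbitrary: n)
  case (Suc j)
  have "(diffs ^^ Suc j) b n = of_nat (Suc n) * (diffs ^^ j) b (Suc n)"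
    by (simp add: diffs_def)
  also have "\<dots> = fact (n + Suc j) / fact n * b (n + Suc j)"
    by (simp add: Suc fact_Suc[of n] del: of_nat_Suc)
  finally show ?case .
qed simp

text \<open>
  Comparison with a geometric series; all tails below are estimated in this way.
\<close>
lemma suminf_le_of_ratio:
  fixes d :: "nat \<Rightarrow> real"
  assumes d: "\<And>n. 0 \<le> d n" "\<And>n. d (Suc n) \<le> k * d n" and k: "0 \<le> k" "k < 1"
  shows "summable d" and "suminf d \<le> d 0 / (1 - k)"
proof -
  have dn: "d n \<le> d 0 * k ^ n" for n
  proof (induction n)
    case (Suc n)
    have "d (Suc n) \<le> k * (d 0 * k ^ n)"
      by (rule order_trans[OF d(2)]) (intro mult_left_mono Suc k)
    thus ?case by (simp add: mult_ac)
  qed simp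
  have g: "(\<lambda>n. d 0 * k ^ n) sums (d 0 * (1 / (1 - k)))"
    using k by (intro sums_mult geometric_sums) auto
  show sm: "summable d"
    by (rule summable_comparison_test'[OF sums_summable[OF g]]) (use dn d in auto)
  have "suminf d \<le> (\<Sum>n. d 0 * k ^ n)" by (intro suminf_le dn sm sums_summable[OF g])
  thus "suminf d \<le> d 0 / (1 - k)" using g by (simp add: sums_iff)
qed

lemma Re_power_series_pos_of_ratio:
  fixes g :: "nat \<Rightarrow> complex"
  assumes g0: "g 0 \<noteq> 0" and r: "\<And>m. norm (g (Suc m)) \<le> k * norm (g m)" and k: "0 \<le> k" "k < 1 / 2"
    and z: "norm z \<le> 1"
  shows "Re ((\<Sum>m. g m * z ^ m) / g 0) > 0"
proof -
  define d where "d = (\<lambda>m. norm (g (Suc m)))"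
  define T where "T = (\<Sum>m. g (Suc m) * z ^ Suc m)"
  have d: "summable d" "suminf d \<le> d 0 / (1 - k)"
    by (rule suminf_le_of_ratio[of d k]; use r k in \<open>simp add: d_def\<close>)+
  have le: "norm (g (Suc m) * z ^ Suc m) \<le> d m" for m
    using mult_left_mono[OF power_le_one[OF norm_ge_zero z, of "Suc m"], of "d m"]
    by (simp add: d_def norm_mult norm_power)
  have "summable (\<lambda>m. g (Suc m) * z ^ Suc m)"
    by (rule summable_comparison_test'[OF d(1)]) (rule le)
  hence sm: "summable (\<lambda>m. g m * z ^ m)" by (subst (asm) summable_Suc_iff)
  have "norm T \<le> suminf d" unfolding T_def by (rule norm_suminf_le[OF le d(1)])
  also have "\<dots> \<le> (k * norm (g 0)) / (1 - k)"
    using d(2) divide_right_mono[OF r[of 0], of "1 - k"] k by (simp add: d_def)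
  also have "\<dots> = norm (g 0) * (k / (1 - k))" by simp
  also have "\<dots> < norm (g 0) * 1" using k g0 by (intro mult_strict_left_mono) auto
  finally have T: "norm (T / g 0) < 1" using g0 by (simp add: norm_divide)
  have "(\<Sum>m. g m * z ^ m) = g 0 + T" using suminf_split_head[OF sm] by (simp add: T_def)
  hence "(\<Sum>m. g m * z ^ m) / g 0 = 1 + T / g 0" using g0 by (simp add: field_simps)
  moreover have "\<bar>Re (T / g 0)\<bar> \<le> norm (T / g 0)" by (rule abs_Re_le_cmod)
  ultimately show ?thesis using T by simp
qed

text \<open>
  The comparison function is \<open>z \<mapsto> h'(0) z\<close>.  The factor \<open>h'(0)\<close> takes care of the sign of the
  leading coefficient, which alternates with \<open>j\<close> in the application.
\<close>
lemma close_to_convex_in_disk_of_ratio: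
  fixes b :: "nat \<Rightarrow> complex"
  assumes sm: "\<And>y. summable (\<lambda>n. b n * y ^ n)"
    and g0: "(diffs ^^ Suc j) b 0 \<noteq> 0"
    and r: "\<And>m. norm ((diffs ^^ Suc j) b (Suc m)) \<le> k * norm ((diffs ^^ Suc j) b m)"
    and k: "0 \<le> k" "k < 1 / 2"
  shows "close_to_convex_in_disk ((deriv ^^ j) (\<lambda>z. \<Sum>n. b n * z ^ n))"
  unfolding close_to_convex_in_disk_def
proof (intro conjI exI[of _ "\<lambda>z. (diffs ^^ Suc j) b 0 * z"] ballI)
  define h where "h = (deriv ^^ j) (\<lambda>z. \<Sum>n. b n * z ^ n)"
  define c where "c = (diffs ^^ Suc j) b 0"
  have h': "(h has_field_derivative (\<Sum>n. (diffs ^^ Suc j) b n * z ^ n)) (at z)" for z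
    unfolding h_def higher_deriv_power_series(2)[OF sm] funpow.simps o_def
    by (rule termdiffs_strong_converges_everywhere) (rule higher_deriv_power_series(1)[OF sm])
  show "h holomorphic_on ball 0 1"
    unfolding holomorphic_on_def field_differentiable_def
    using has_field_derivative_at_within[OF h'] by blast
  show "(\<lambda>z. c * z) holomorphic_on ball 0 1" by (intro holomorphic_intros)
  show "inj_on (\<lambda>z. c * z) (ball 0 1)" using g0 by (auto simp: inj_on_def c_def)
  show "convex ((\<lambda>z. c * z) ` ball 0 1)"
    by (intro convex_linear_image linear_times) auto
  fix z :: complex assume z: "z \<in> ball 0 1"
  have "deriv (\<lambda>z. c * z) z = c"
    by (rule DERIV_imp_deriv) (auto intro!: derivative_eq_intros)
  moreover have "deriv h z = (\<Sum>n. (diffs ^^ Suc j) b n * z ^ n)" by (rule DERIV_imp_deriv[OF h'])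
  moreover have "norm z \<le> 1" using z by simp
  ultimately show "Re (deriv h z / deriv (\<lambda>z. c * z) z) > 0"
    using Re_power_series_pos_of_ratio[OF g0 r k, of z] by (simp only: c_def)
qed

text \<open>
  On the unit circle this is \<open>\<bar>1 - z\<^sup>n\<bar> \<le> n \<bar>1 - z\<bar>\<close> squared, since there
  \<open>2 Re (1 - w) = \<bar>1 - w\<bar>\<^sup>2\<close>; inside, the defect \<open>1 - \<bar>w\<bar>\<^sup>2\<close> is estimated separately.
\<close>
lemma Re_one_minus_power:
  fixes z :: complex
  assumes z: "norm z \<le> 1"
  shows "0 \<le> Re (1 - z ^ n)" and "Re (1 - z ^ n) \<le> (real n)\<^sup>2 * Re (1 - z)"
proof -
  have zn: "norm (z ^ n) \<le> 1" using z by (simp add: norm_power power_le_one)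
  show "0 \<le> Re (1 - z ^ n)" using complex_Re_le_cmod[of "z ^ n"] zn by simp
  have id: "2 * Re (1 - w) = (norm (1 - w))\<^sup>2 + (1 - (norm w)\<^sup>2)" for w
    by (simp add: cmod_power2) (simp add: power2_eq_square algebra_simps)
  have n1: "norm (1 - z ^ n) \<le> real n * norm (1 - z)"
    using norm_power_diff[of 1 z n] z by simp
  hence "(norm (1 - z ^ n))\<^sup>2 \<le> (real n * norm (1 - z))\<^sup>2" by (intro power_mono) auto
  hence 1: "(norm (1 - z ^ n))\<^sup>2 \<le> (real n)\<^sup>2 * (norm (1 - z))\<^sup>2" by (simp add: power_mult_distrib)
  define s where "s = (norm z)\<^sup>2"
  have s: "0 \<le> s" "s \<le> 1" using z by (auto simp: s_def power_le_one)
  have "norm (1 ^ n - s ^ n) \<le> real n * norm (1 - s)"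
    using s by (intro norm_power_diff) auto
  hence "1 - s ^ n \<le> real n * (1 - s)" using s by simp
  also have "\<dots> \<le> (real n)\<^sup>2 * (1 - s)"
  proof (intro mult_right_mono)
    show "real n \<le> (real n)\<^sup>2" by (cases n) (auto simp: power2_eq_square)
  qed (use s in auto)
  finally have "1 - (norm (z ^ n))\<^sup>2 \<le> (real n)\<^sup>2 * (1 - (norm z)\<^sup>2)"
    by (simp add: s_def norm_power power_mult[symmetric] mult.commute)
  with 1 id[of z] id[of "z ^ n"] have "2 * Re (1 - z ^ n) \<le> (real n)\<^sup>2 * (2 * Re (1 - z))"
    by (simp only: distrib_left)
  hence "2 * Re (1 - z ^ n) \<le> 2 * ((real n)\<^sup>2 * Re (1 - z))" by (simp only: mult.left_commute)
  thus "Re (1 - z ^ n) \<le> (real n)\<^sup>2 * Re (1 - z)" by (rule mult_left_le_imp_le) simp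
qed

text \<open>
  A first-order expansion at the boundary point \<open>1\<close>.  The remainder is controlled twice: its modulus
  by \<open>\<bar>1 - z\<bar>\<close>, and its real part by the much smaller \<open>Re (1 - z)\<close>.  The weight \<open>n\<^sup>2\<close> is forced by
  the second estimate; for \<open>n \<ge> 2\<close> it is at least twice the weight \<open>n\<close> that the first one needs, hence
  the factor \<open>1/2\<close>.
\<close>
lemma power_series_expand_at_one:
  fixes e :: "nat \<Rightarrow> real" and z :: complex
  assumes sm: "summable (\<lambda>n. (real (n + 2))\<^sup>2 * \<bar>e (n + 2)\<bar>)"
    and M: "(\<Sum>n. (real (n + 2))\<^sup>2 * \<bar>e (n + 2)\<bar>) \<le> M" and z: "norm z \<le> 1"
  obtains R where "(\<Sum>n. of_real (e n) * z ^ n) = of_real (\<Sum>n. e n) - of_real (e 1) * (1 - z) - R"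
    and "norm R \<le> M / 2 * norm (1 - z)" and "\<bar>Re R\<bar> \<le> M * Re (1 - z)"
proof -
  have sa: "summable (\<lambda>n. \<bar>e n\<bar>)"
  proof -
    have "summable (\<lambda>n. \<bar>e (n + 2)\<bar>)"
    proof (rule summable_comparison_test'[OF sm])
      fix n
      have "1 * \<bar>e (n + 2)\<bar> \<le> (real (n + 2))\<^sup>2 * \<bar>e (n + 2)\<bar>"
        by (intro mult_right_mono) (auto simp: power2_eq_square algebra_simps)
      thus "norm \<bar>e (n + 2)\<bar> \<le> (real (n + 2))\<^sup>2 * \<bar>e (n + 2)\<bar>" by simp
    qed
    thus ?thesis by (subst (asm) summable_iff_shift)
  qed
  have se: "summable e" by (rule summable_rabs_cancel[OF sa])
  have s1: "summable (\<lambda>n. of_real (e n) * z ^ n)"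
  proof (rule summable_comparison_test'[OF sa])
    fix n show "norm (of_real (e n) * z ^ n) \<le> \<bar>e n\<bar>"
      using mult_left_mono[OF power_le_one[OF norm_ge_zero z, of n], of "\<bar>e n\<bar>"]
      by (simp add: norm_mult norm_power)
  qed
  define u where "u = (\<lambda>n. of_real (e n) * (1 - z ^ n))"
  define R where "R = (\<Sum>n. u (n + 2))"
  have "(\<lambda>n. of_real (e n) - of_real (e n) * z ^ n) sums (of_real (\<Sum>n. e n) - (\<Sum>n. of_real (e n) * z ^ n))"
    by (intro sums_diff sums_of_real summable_sums se s1)
  hence u: "u sums (of_real (\<Sum>n. e n) - (\<Sum>n. of_real (e n) * z ^ n))"
    by (simp add: u_def algebra_simps)
  have "suminf u = R + (\<Sum>n<2. u n)"
    unfolding R_def by (rule suminf_split_initial_segment[OF sums_summable[OF u]])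
  also have "(\<Sum>n<2. u n) = of_real (e 1) * (1 - z)" by (simp add: u_def numeral_2_eq_2)
  finally have "suminf u = R + of_real (e 1) * (1 - z)" .
  hence 1: "(\<Sum>n. of_real (e n) * z ^ n) = of_real (\<Sum>n. e n) - of_real (e 1) * (1 - z) - R"
    using sums_unique[OF u] by (simp only: eq_diff_eq diff_eq_eq ac_simps)
  have su: "summable (\<lambda>n. u (n + 2))" using summable_ignore_initial_segment[OF sums_summable[OF u]] .
  have X: "Re (1 - z) \<ge> 0" using Re_one_minus_power(1)[OF z, of 1] by simp
  have "norm R \<le> (\<Sum>n. (real (n + 2))\<^sup>2 * \<bar>e (n + 2)\<bar> * (norm (1 - z) / 2))"
    unfolding R_def
  proof (rule norm_suminf_le)
    fix n
    have "norm (1 - z ^ (n + 2)) \<le> real (n + 2) * norm (1 - z)"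
      using norm_power_diff[of 1 z "n + 2"] z by simp
    also have "\<dots> \<le> (real (n + 2))\<^sup>2 / 2 * norm (1 - z)"
      by (intro mult_right_mono) (auto simp: power2_eq_square field_simps)
    finally have "\<bar>e (n + 2)\<bar> * norm (1 - z ^ (n + 2)) \<le> \<bar>e (n + 2)\<bar> * ((real (n + 2))\<^sup>2 / 2 * norm (1 - z))"
      by (intro mult_left_mono) auto
    thus "norm (u (n + 2)) \<le> (real (n + 2))\<^sup>2 * \<bar>e (n + 2)\<bar> * (norm (1 - z) / 2)"
      by (simp add: u_def norm_mult mult_ac)
  qed (rule summable_mult2[OF sm])
  also have "\<dots> = (\<Sum>n. (real (n + 2))\<^sup>2 * \<bar>e (n + 2)\<bar>) * (norm (1 - z) / 2)"
    by (rule suminf_mult2[OF sm, symmetric])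
  also have "\<dots> \<le> M * (norm (1 - z) / 2)" by (intro mult_right_mono M) auto
  finally have 2: "norm R \<le> M / 2 * norm (1 - z)" by simp
  have "Re R = (\<Sum>n. Re (u (n + 2)))" unfolding R_def by (rule Re_suminf[OF su])
  also have "norm \<dots> \<le> (\<Sum>n. (real (n + 2))\<^sup>2 * \<bar>e (n + 2)\<bar> * Re (1 - z))"
  proof (rule norm_suminf_le)
    fix n
    have "\<bar>e (n + 2)\<bar> * Re (1 - z ^ (n + 2)) \<le> \<bar>e (n + 2)\<bar> * ((real (n + 2))\<^sup>2 * Re (1 - z))"
      by (intro mult_left_mono Re_one_minus_power(2)[OF z]) auto
    moreover have "Re (u (n + 2)) = e (n + 2) * Re (1 - z ^ (n + 2))" by (simp add: u_def)
    ultimately show "norm (Re (u (n + 2))) \<le> (real (n + 2))\<^sup>2 * \<bar>e (n + 2)\<bar> * Re (1 - z)"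
      using Re_one_minus_power(1)[OF z, of "n + 2"] by (simp add: abs_mult mult_ac)
  qed (rule summable_mult2[OF sm])
  also have "\<dots> = (\<Sum>n. (real (n + 2))\<^sup>2 * \<bar>e (n + 2)\<bar>) * Re (1 - z)"
    by (rule suminf_mult2[OF sm, symmetric])
  also have "\<dots> \<le> M * Re (1 - z)" by (intro mult_right_mono M X)
  finally have 3: "\<bar>Re R\<bar> \<le> M * Re (1 - z)" by simp
  from that[OF 1 2 3] show thesis .
qed

text \<open>
  The coefficient sequence of \<open>z p(z)\<close>, needed because higher derivatives are read off from \<open>f\<close> and
  not from \<open>f(z)/z\<close>.
\<close>
lemma sums_shifted_power_series:
  fixes a :: "nat \<Rightarrow> complex"
  assumes "summable (\<lambda>n. a n * z ^ n)"
  shows "(\<lambda>n. case_nat 0 a n * z ^ n) sums (z * (\<Sum>n. a n * z ^ n))"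
proof (rule sums_Suc_imp)
  show "(\<lambda>n. case_nat 0 a (Suc n) * z ^ Suc n) sums (z * (\<Sum>n. a n * z ^ n))"
    using sums_mult[OF summable_sums[OF assms], of z] by (simp add: mult_ac)
qed simp

lemma deriv_shifted_power_series:
  fixes a :: "nat \<Rightarrow> complex"
  assumes sa: "\<And>y. summable (\<lambda>n. a n * y ^ n)"
  shows "((\<lambda>z. z * (\<Sum>n. a n * z ^ n)) has_field_derivative (\<Sum>n. of_nat (Suc n) * a n * z ^ n)) (at z)"
proof -
  note S = sums_shifted_power_series[OF sa]
  have "((\<lambda>z. \<Sum>n. case_nat 0 a n * z ^ n) has_field_derivative (\<Sum>n. diffs (case_nat 0 a) n * z ^ n)) (at z)"
    by (rule termdiffs_strong_converges_everywhere) (rule sums_summable[OF S])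
  moreover have "(\<Sum>n. case_nat 0 a n * w ^ n) = w * (\<Sum>n. a n * w ^ n)" for w
    by (rule sums_unique[OF S, symmetric])
  ultimately show ?thesis by (simp add: diffs_def)
qed

text \<open>
  Let \<open>p(z) = f(z)/z\<close> and \<open>q = f'\<close>, and write \<open>p(z) = p(1) + P\<close> and \<open>q(z) = q(1) + Q\<close>, where \<open>P\<close> and \<open>Q\<close> are close to
  \<open>c (1 - z)\<close> and \<open>2 c (1 - z)\<close>.  Then \<open>Re Q\<close> is positive and \<open>Re P\<close>, \<open>Re (Q P\<^sup>*)\<close> are nonnegative, so that
  \<open>q(1) \<ge> 0\<close> and \<open>p(1) > 0\<close> yield \<open>Re f' > 0\<close> and \<open>Re (f' (f/z)\<^sup>*) > 0\<close>; the latter has the sign of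
  \<open>Re (z f'/f)\<close>.  The hypothesis on the sum bounds the remainders of \<open>f'\<close>, and a third of it those
  of \<open>f(z)/z\<close>.
\<close>
lemma starlike_in_disk_power_series:
  fixes a :: "nat \<Rightarrow> real" and c :: real
  assumes sa: "\<And>y :: complex. summable (\<lambda>n. of_real (a n) * y ^ n)"
    and a0: "a 0 = 1" and a1: "a 1 = - c" and c: "0 < c" "c < 4 / 5"
    and sD: "summable (\<lambda>n. (real (n + 2))\<^sup>2 * (real (n + 3) * \<bar>a (n + 2)\<bar>))"
    and D: "(\<Sum>n. (real (n + 2))\<^sup>2 * (real (n + 3) * \<bar>a (n + 2)\<bar>)) \<le> 3 / 2 * c"
    and q1: "0 \<le> (\<Sum>n. real (Suc n) * a n)"
    and f: "\<And>z. f z = z * (\<Sum>n. of_real (a n) * z ^ n)"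
  shows "starlike_in_disk f"
proof -
  define p where "p = (\<lambda>z::complex. \<Sum>n. of_real (a n) * z ^ n)"
  define q where "q = (\<lambda>z::complex. \<Sum>n. of_real (real (Suc n) * a n) * z ^ n)"
  define p1 where "p1 = (\<Sum>n. a n)"
  define q1 where "q1 = (\<Sum>n. real (Suc n) * a n)"
  have q1: "q1 \<ge> 0" using q1 by (simp add: q1_def)
  have "f = (\<lambda>z. z * (\<Sum>n. of_real (a n) * z ^ n))" using f by (rule ext)
  hence f': "(f has_field_derivative q z) (at z)" for z
    using deriv_shifted_power_series[OF sa] by (simp add: q_def)
  have df: "deriv f z = q z" for z by (rule DERIV_imp_deriv[OF f'])
  have hol: "f holomorphic_on ball 0 1"
    unfolding holomorphic_on_def field_differentiable_def
    using has_field_derivative_at_within[OF f'] by blast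
  have key: "Re (q z) > 0 \<and> Re (q z * cnj (p z)) > 0" if z: "norm z < 1" for z
  proof -
    define X where "X = Re (1 - z)"
    define N where "N = norm (1 - z)"
    have X: "X > 0" using complex_Re_le_cmod[of z] z by (simp add: X_def)
    have z1: "norm z \<le> 1" using z by simp
    have eq: "\<bar>real (Suc (n + 2)) * a (n + 2)\<bar> = real (n + 3) * \<bar>a (n + 2)\<bar>" for n
      unfolding abs_mult by simp
    have sm: "summable (\<lambda>n. (real (n + 2))\<^sup>2 * \<bar>real (Suc (n + 2)) * a (n + 2)\<bar>)"
      unfolding eq by (rule sD)
    have "(\<Sum>n. (real (n + 2))\<^sup>2 * \<bar>real (Suc (n + 2)) * a (n + 2)\<bar>) \<le> 3 / 2 * c"
      unfolding eq by (rule D)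
    then obtain S where S: "q z = of_real q1 - of_real (real (Suc 1) * a 1) * (1 - z) - S"
        "norm S \<le> 3 / 2 * c / 2 * N" "\<bar>Re S\<bar> \<le> 3 / 2 * c * X"
      using power_series_expand_at_one[OF sm _ z1, of "3 / 2 * c"]
      unfolding q_def q1_def N_def X_def by blast
    have le: "(real (n + 2))\<^sup>2 * \<bar>a (n + 2)\<bar> \<le> (real (n + 2))\<^sup>2 * (real (n + 3) * \<bar>a (n + 2)\<bar>) * (1 / 3)" for n
    proof -
      have "(real (n + 2))\<^sup>2 * \<bar>a (n + 2)\<bar> * 1 \<le> (real (n + 2))\<^sup>2 * \<bar>a (n + 2)\<bar> * (real (n + 3) * (1 / 3))"
        by (intro mult_left_mono) auto
      thus ?thesis by (simp only: mult_ac mult_1_right mult_1_left)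
    qed
    have sm': "summable (\<lambda>n. (real (n + 2))\<^sup>2 * \<bar>a (n + 2)\<bar>)"
      by (rule summable_comparison_test'[OF summable_mult2[OF sD, of "1 / 3"]]) (use le in simp)
    have "(\<Sum>n. (real (n + 2))\<^sup>2 * \<bar>a (n + 2)\<bar>) \<le>
            (\<Sum>n. (real (n + 2))\<^sup>2 * (real (n + 3) * \<bar>a (n + 2)\<bar>) * (1 / 3))"
      by (intro suminf_le le sm' summable_mult2 sD)
    also have "\<dots> = (\<Sum>n. (real (n + 2))\<^sup>2 * (real (n + 3) * \<bar>a (n + 2)\<bar>)) * (1 / 3)"
      by (rule suminf_mult2[OF sD, symmetric])
    finally have D': "(\<Sum>n. (real (n + 2))\<^sup>2 * \<bar>a (n + 2)\<bar>) \<le> c / 2" using D by simp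
    have expp: "\<exists>R. p w = of_real p1 + of_real c * (1 - w) - R \<and> norm R \<le> c / 4 * norm (1 - w) \<and>
        \<bar>Re R\<bar> \<le> c / 2 * Re (1 - w)" if w: "norm w \<le> 1" for w
    proof -
      obtain R where "p w = of_real p1 - of_real (a 1) * (1 - w) - R"
          "norm R \<le> c / 2 / 2 * norm (1 - w)" "\<bar>Re R\<bar> \<le> c / 2 * Re (1 - w)"
        using power_series_expand_at_one[OF sm' D' w] unfolding p_def p1_def by blast
      thus ?thesis using a1 by (intro exI[of _ R]) simp
    qed
    obtain R where R: "p z = of_real p1 + of_real c * (1 - z) - R" "norm R \<le> c / 4 * N"
        "\<bar>Re R\<bar> \<le> c / 2 * X"
      using expp[OF z1] unfolding N_def X_def by blast
    \<comment> \<open>the same expansion at \<open>z = 0\<close>, where \<open>p = 1\<close>, gives \<open>p(1) \<ge> 1 - 5 c / 4\<close>\<close>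
    have p1: "p1 > 0"
    proof -
      obtain R0 where R0: "p 0 = of_real p1 + of_real c * (1 - 0) - R0" "norm R0 \<le> c / 4 * norm (1 - 0 :: complex)"
        using expp[of 0] by auto
      have "p 0 = 1" using a0 powser_zero[of "\<lambda>n. of_real (a n) :: complex"] by (simp add: p_def)
      hence "R0 = of_real (p1 + c - 1)" using R0(1) by (simp add: algebra_simps)
      hence "\<bar>p1 + c - 1\<bar> \<le> c / 4" using R0(2) by (simp only: norm_of_real) simp
      thus ?thesis using c by linarith
    qed
    define P where "P = of_real c * (1 - z) - R"
    define Q where "Q = of_real (2 * c) * (1 - z) - S"
    have pP: "p z = of_real p1 + P" using R(1) by (simp add: P_def)
    have qQ: "q z = of_real q1 + Q" using S(1) a1 by (simp add: Q_def)
    have "Re P = c * X - Re R" by (simp add: P_def X_def)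
    hence ReP: "Re P \<ge> 0" using R(3) c X mult_pos_pos[OF c(1) X] by (simp add: abs_le_iff)
    have "Re Q = 2 * c * X - Re S" by (simp add: Q_def X_def)
    hence ReQ: "Re Q > 0" using S(3) mult_pos_pos[OF c(1) X] by (simp add: abs_le_iff)
    have N: "N > 0" using X by (auto simp: N_def X_def)
    \<comment> \<open>the main term is \<open>2 c\<^sup>2 N\<^sup>2\<close>, the errors add up to at most \<open>(1/2 + 3/4 + 3/16) c\<^sup>2 N\<^sup>2\<close>\<close>
    have "Re (Q * cnj P) \<ge> 0"
    proof -
      define T where "T = of_real (2 * c) * (1 - z) * cnj R + S * cnj (of_real c * (1 - z)) - S * cnj R"
      have "Q * cnj P = of_real (2 * c) * (1 - z) * cnj (of_real c * (1 - z)) - T"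
        by (simp add: Q_def P_def T_def algebra_simps)
      also have "of_real (2 * c) * (1 - z) * cnj (of_real c * (1 - z)) = of_real (2 * c * c * N\<^sup>2)"
        unfolding N_def
        by (simp only: of_real_mult complex_norm_square complex_cnj_mult complex_cnj_complex_of_real mult_ac)
      finally have "Re (Q * cnj P) = 2 * c * c * N\<^sup>2 - Re T" by simp
      moreover have "Re T \<le> norm T" by (rule complex_Re_le_cmod)
      moreover have "norm T \<le> 2 * c * N * norm R + norm S * (c * N) + norm S * norm R"
      proof -
        have "norm T \<le> norm (of_real (2 * c) * (1 - z) * cnj R + S * cnj (of_real c * (1 - z))) + norm (S * cnj R)"
          unfolding T_def by (rule norm_triangle_ineq4)
        also have "\<dots> \<le> norm (of_real (2 * c) * (1 - z) * cnj R) + norm (S * cnj (of_real c * (1 - z))) + norm (S * cnj R)"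
          by (intro add_right_mono norm_triangle_ineq)
        also have "\<dots> = 2 * c * N * norm R + norm S * (c * N) + norm S * norm R"
          using c unfolding norm_mult complex_mod_cnj by (simp add: N_def)
        finally show ?thesis .
      qed
      moreover have "2 * c * N * norm R \<le> 2 * c * N * (c / 4 * N)"
        using c N R(2) by (intro mult_left_mono) auto
      moreover have "norm S * (c * N) \<le> (3 / 2 * c / 2 * N) * (c * N)"
        using c N S(2) by (intro mult_right_mono) auto
      moreover have "norm S * norm R \<le> (3 / 2 * c / 2 * N) * (c / 4 * N)"
        using c N S(2) R(2) by (intro mult_mono) auto
      moreover have "2 * c * N * (c / 4 * N) + (3 / 2 * c / 2 * N) * (c * N) + (3 / 2 * c / 2 * N) * (c / 4 * N)
          \<le> 2 * c * c * N\<^sup>2"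
      proof -
        have "2 * c * N * (c / 4 * N) + (3 / 2 * c / 2 * N) * (c * N) + (3 / 2 * c / 2 * N) * (c / 4 * N)
            = 23 / 16 * (c * c * N\<^sup>2)" by (simp add: power2_eq_square)
        also have "\<dots> \<le> 2 * (c * c * N\<^sup>2)" by (intro mult_right_mono) auto
        finally show ?thesis by simp
      qed
      ultimately show ?thesis by linarith
    qed
    moreover have "Re (q z * cnj (p z)) = q1 * p1 + q1 * Re P + p1 * Re Q + Re (Q * cnj P)"
      by (simp add: pP qQ algebra_simps)
    moreover have "q1 * p1 \<ge> 0" "q1 * Re P \<ge> 0" "p1 * Re Q > 0"
      using q1 p1 ReP ReQ by auto
    ultimately have "Re (q z * cnj (p z)) > 0" by linarith
    moreover have "Re (q z) > 0" using q1 ReQ qQ by simp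
    ultimately show ?thesis by blast
  qed
  show ?thesis
  proof (rule starlike_in_diskI[OF hol])
    show "f 0 = 0" by (simp add: f)
    show "inj_on f (ball 0 1)"
      using key by (intro Re_deriv_pos_imp_inj_on[OF open_ball convex_ball hol]) (simp add: df)
    fix z :: complex assume z: "z \<in> ball 0 1" "z \<noteq> 0"
    have pos: "Re (q z * cnj (p z)) > 0" using key[of z] z by simp
    hence "p z \<noteq> 0" by auto
    have "z * deriv f z / f z = q z / p z" using z by (simp add: df f p_def)
    also have "\<dots> = q z * cnj (p z) / of_real ((norm (p z))\<^sup>2)"
      by (subst complex_div_cnj) simp
    finally have "z * deriv f z / f z = q z * cnj (p z) / of_real ((norm (p z))\<^sup>2)" .
    hence "Re (z * deriv f z / f z) = Re (q z * cnj (p z)) / (norm (p z))\<^sup>2"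
      by (simp only: Re_divide_of_real)
    thus "Re (z * deriv f z / f z) > 0" using pos \<open>p z \<noteq> 0\<close> by simp
  qed
qed

text \<open>
  On \<open>[0,1]\<close> the derivative is real and continuous and starts at \<open>1\<close>.  A negative value at \<open>1\<close> would
  force a zero in \<open>[0,1)\<close>, which univalence excludes.
\<close>
lemma inj_on_disk_imp_deriv_at_one_nonneg:
  fixes a :: "nat \<Rightarrow> real"
  assumes sa: "\<And>y :: complex. summable (\<lambda>n. of_real (a n) * y ^ n)" and a0: "a 0 = 1"
    and inj: "inj_on f (ball 0 1)" and hol: "f holomorphic_on ball 0 1"
    and f': "\<And>z. z \<in> ball 0 1 \<Longrightarrow> deriv f z = (\<Sum>n. of_real (a n) * z ^ n)"
  shows "0 \<le> (\<Sum>n. a n)"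
proof (rule ccontr)
  define g where "g = (\<lambda>x::real. \<Sum>n. a n * x ^ n)"
  have sr: "summable (\<lambda>n. a n * x ^ n)" for x
    using summable_Re[OF sa[of "of_real x"]] by (simp flip: of_real_power)
  assume "\<not> 0 \<le> (\<Sum>n. a n)"
  hence g1: "g 1 < 0" by (simp add: g_def)
  have "g 0 = 1" using powser_zero[of a] a0 by (simp add: g_def)
  moreover have "isCont g x" for x
    unfolding g_def by (rule DERIV_isCont[OF termdiffs_strong_converges_everywhere[OF sr]])
  ultimately obtain x where x: "0 \<le> x" "x \<le> 1" "g x = 0"
    using IVT2[of g 1 0 0] g1 by auto
  have "x \<noteq> 1" using x g1 by auto
  hence xb: "complex_of_real x \<in> ball 0 1" using x by simp
  have "(\<lambda>n. of_real (a n * x ^ n)) sums complex_of_real (g x)"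
    unfolding g_def by (intro sums_of_real summable_sums sr)
  hence "deriv f (of_real x) = of_real (g x)" using f'[OF xb] by (simp add: sums_iff)
  moreover have "deriv f (of_real x) \<noteq> 0"
    by (rule holomorphic_injective_imp_regular[OF hol open_ball inj xb])
  ultimately show False using x by simp
qed

section \<open>Taylor coefficients of the normalized third derivative\<close>

text \<open>
  The factor that three differentiations of \<open>z\<^bsup>2n+\<nu>\<^esup>\<close> produce.
\<close>
definition J3_num :: "real \<Rightarrow> nat \<Rightarrow> real" where
  "J3_num \<nu> n = (2 * real n + \<nu>) * (2 * real n + \<nu> - 1) * (2 * real n + \<nu> - 2)"

text \<open>
  The absolute values of the Taylor coefficients, multiplied by \<open>(\<nu> - 1) (\<nu> - 2)\<close>.  This
  factor removes the poles at \<open>\<nu> = 1\<close> and \<open>\<nu> = 2\<close>, so that monotonicity in \<open>\<nu>\<close> can be studied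
  on the closed half-line \<open>\<nu> \<ge> 2\<close>.
\<close>
definition J3_term :: "real \<Rightarrow> nat \<Rightarrow> real" where
  "J3_term \<nu> n = J3_num \<nu> n / (fact n * 4 ^ n * pochhammer \<nu> (Suc n))"

definition J3_coeff :: "real \<Rightarrow> nat \<Rightarrow> real" where
  "J3_coeff \<nu> n = (- 1) ^ n * J3_term \<nu> n / ((\<nu> - 1) * (\<nu> - 2))"

lemma J3_num_nonneg: "\<nu> \<ge> 2 \<Longrightarrow> J3_num \<nu> n \<ge> 0"
  by (simp add: J3_num_def)

lemma J3_term_nonneg: "\<nu> \<ge> 2 \<Longrightarrow> J3_term \<nu> n \<ge> 0"
  unfolding J3_term_def by (intro divide_nonneg_nonneg mult_nonneg_nonneg J3_num_nonneg pochhammer_nonneg) auto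

lemma J3_term_pos: "\<nu> > 2 \<Longrightarrow> J3_term \<nu> n > 0"
  unfolding J3_term_def J3_num_def by (intro divide_pos_pos mult_pos_pos pochhammer_pos) auto

lemma J3_term_explicit:
  assumes "\<nu> > 0"
  shows "J3_term \<nu> 0 = (\<nu> - 1) * (\<nu> - 2)"
    and "J3_term \<nu> 1 = (\<nu> + 2) / 4"
    and "J3_term \<nu> 2 = (\<nu> + 4) * (\<nu> + 3) / (32 * \<nu> * (\<nu> + 1))"
    and "J3_term \<nu> 3 = (\<nu> + 6) * (\<nu> + 5) * (\<nu> + 4) / (384 * (\<nu> * (\<nu> + 1) * (\<nu> + 2) * (\<nu> + 3)))"
proof -
  have p1: "pochhammer \<nu> 2 = \<nu> * (\<nu> + 1)"
    by (simp add: numeral_2_eq_2 pochhammer_Suc)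
  have p2: "pochhammer \<nu> 3 = \<nu> * (\<nu> + 1) * (\<nu> + 2)"
    using pochhammer_Suc[of \<nu> 2] p1 by (simp add: numeral_3_eq_3 numeral_2_eq_2)
  have p3: "pochhammer \<nu> 4 = \<nu> * (\<nu> + 1) * (\<nu> + 2) * (\<nu> + 3)"
    using pochhammer_Suc[of \<nu> 3] p2 by (simp add: eval_nat_numeral)
  have nz: "\<nu> \<noteq> 0" "\<nu> + 1 \<noteq> 0" "\<nu> + 2 \<noteq> 0" "\<nu> + 3 \<noteq> 0" using assms by auto
  show "J3_term \<nu> 0 = (\<nu> - 1) * (\<nu> - 2)"
    using assms by (simp add: J3_term_def J3_num_def)
  have "J3_term \<nu> 1 = (\<nu> + 2) * (\<nu> + 1) * \<nu> / (4 * (\<nu> * (\<nu> + 1)))"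
    using p1 by (simp add: J3_term_def J3_num_def numeral_2_eq_2 add_ac)
  thus "J3_term \<nu> 1 = (\<nu> + 2) / 4" using nz by (simp add: divide_simps)
  have "J3_term \<nu> 2 = (\<nu> + 4) * (\<nu> + 3) * (\<nu> + 2) / (2 * 16 * (\<nu> * (\<nu> + 1) * (\<nu> + 2)))"
    using p2 by (simp add: J3_term_def J3_num_def eval_nat_numeral add_ac)
  thus "J3_term \<nu> 2 = (\<nu> + 4) * (\<nu> + 3) / (32 * \<nu> * (\<nu> + 1))" using nz by (simp add: divide_simps)
  have "J3_term \<nu> 3 = (\<nu> + 6) * (\<nu> + 5) * (\<nu> + 4) / (6 * 64 * (\<nu> * (\<nu> + 1) * (\<nu> + 2) * (\<nu> + 3)))"
    using p3 by (simp add: J3_term_def J3_num_def eval_nat_numeral add_ac)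
  thus "J3_term \<nu> 3 = (\<nu> + 6) * (\<nu> + 5) * (\<nu> + 4) / (384 * (\<nu> * (\<nu> + 1) * (\<nu> + 2) * (\<nu> + 3)))"
    by simp
qed

lemma J3_coeff_0_1:
  assumes "\<nu> > 2"
  shows "J3_coeff \<nu> 0 = 1" and "J3_coeff \<nu> 1 = - ((\<nu> + 2) / (4 * ((\<nu> - 1) * (\<nu> - 2))))"
proof -
  show "J3_coeff \<nu> 0 = 1" using assms J3_term_explicit(1)[of \<nu>] by (simp add: J3_coeff_def)
  have "J3_term \<nu> 1 = (\<nu> + 2) / 4" using assms by (intro J3_term_explicit) auto
  thus "J3_coeff \<nu> 1 = - ((\<nu> + 2) / (4 * ((\<nu> - 1) * (\<nu> - 2))))" 
    by (simp only: J3_coeff_def power_one_right mult_minus1 minus_divide_left[symmetric] divide_divide_eq_left)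
qed

lemma normalized_bessel_J3_power_series:
  fixes \<nu> :: real
  assumes \<nu>: "\<nu> > 2"
  shows "summable (\<lambda>n. complex_of_real (J3_coeff \<nu> n) * z ^ n)"
    and "normalized_bessel_J3 \<nu> z = z * (\<Sum>n. of_real (J3_coeff \<nu> n) * z ^ n)"
proof -
  have coeff: "(- 1) ^ n * Gamma (of_real \<nu> - 2)
            * ((2 * of_nat n + of_real \<nu>) * (2 * of_nat n + of_real \<nu> - 1) * (2 * of_nat n + of_real \<nu> - 2))
            / (fact n * Gamma (of_nat n + of_real \<nu> + 1) * 4 ^ n) = complex_of_real (J3_coeff \<nu> n)" for n
  proof -
    have v: "\<nu> - 2 \<notin> \<int>\<^sub>\<le>\<^sub>0" using \<nu> by (auto elim!: nonpos_Ints_cases)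
    have "Gamma (\<nu> - 2) > 0" by (rule Gamma_real_pos) (use \<nu> in simp)
    hence G0: "Gamma (\<nu> - 2) \<noteq> 0" by linarith
    have "pochhammer (\<nu> - 2) (n + 3) = Gamma (\<nu> - 2 + of_nat (n + 3)) / Gamma (\<nu> - 2)"
      by (rule pochhammer_Gamma[OF v])
    hence "Gamma (real n + \<nu> + 1) = Gamma (\<nu> - 2) * pochhammer (\<nu> - 2) (n + 3)"
      using G0 by (simp add: add_ac)
    also have "pochhammer (\<nu> - 2) (n + 3) = (\<nu> - 2) * (\<nu> - 1) * pochhammer \<nu> (Suc n)"
      using pochhammer_rec[of "\<nu> - 2" "Suc (Suc n)"] pochhammer_rec[of "\<nu> - 1" "Suc n"]
      by (simp add: numeral_3_eq_3)
    finally have G: "Gamma (real n + \<nu> + 1) = Gamma (\<nu> - 2) * ((\<nu> - 2) * (\<nu> - 1) * pochhammer \<nu> (Suc n))" .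
    have "Gamma (of_nat n + of_real \<nu> + 1 :: complex) = of_real (Gamma (real n + \<nu> + 1))"
         "Gamma (of_real \<nu> - 2 :: complex) = of_real (Gamma (\<nu> - 2))"
      by (simp_all flip: Gamma_complex_of_real)
    hence "(- 1) ^ n * Gamma (of_real \<nu> - 2)
            * ((2 * of_nat n + of_real \<nu>) * (2 * of_nat n + of_real \<nu> - 1) * (2 * of_nat n + of_real \<nu> - 2))
            / (fact n * Gamma (of_nat n + of_real \<nu> + 1) * 4 ^ n)
          = complex_of_real ((- 1) ^ n * Gamma (\<nu> - 2) * J3_num \<nu> n / (fact n * Gamma (real n + \<nu> + 1) * 4 ^ n))"
      by (simp add: J3_num_def)
    also have "(- 1) ^ n * Gamma (\<nu> - 2) * J3_num \<nu> n / (fact n * Gamma (real n + \<nu> + 1) * 4 ^ n) = J3_coeff \<nu> n"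
      unfolding G J3_coeff_def J3_term_def using G0 \<nu>
      by (simp add: divide_simps mult_ac)
    finally show ?thesis .
  qed
  have s: "(\<lambda>n. of_real (J3_coeff \<nu> n) * z ^ Suc n) sums normalized_bessel_J3 \<nu> z" for z
    using normalized_bessel_J3_sums[OF \<nu>, of z] unfolding coeff .
  have sm: "summable (\<lambda>n. complex_of_real (J3_coeff \<nu> n) * z ^ n)" for z
  proof (cases "z = 0")
    case False
    have "summable (\<lambda>n. of_real (J3_coeff \<nu> n) * z ^ Suc n / z)"
      using s[of z] by (intro summable_divide) (rule sums_summable)
    thus ?thesis using False by simp
  qed (simp add: powser_zero)
  show "summable (\<lambda>n. complex_of_real (J3_coeff \<nu> n) * z ^ n)" by (rule sm)
  have "(\<lambda>n. z * (of_real (J3_coeff \<nu> n) * z ^ n)) sums (z * (\<Sum>n. of_real (J3_coeff \<nu> n) * z ^ n))"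
    by (intro sums_mult summable_sums sm)
  hence "(\<lambda>n. of_real (J3_coeff \<nu> n) * z ^ Suc n) sums (z * (\<Sum>n. of_real (J3_coeff \<nu> n) * z ^ n))"
    by (simp add: mult_ac)
  thus "normalized_bessel_J3 \<nu> z = z * (\<Sum>n. of_real (J3_coeff \<nu> n) * z ^ n)"
    using s sums_unique2 by blast
qed

text \<open>
  With \<open>m = 2n + \<nu>\<close>, the quotient \<open>(m + 2) (m + 1) / ((m - 1) (m - 2))\<close> of consecutive numerators
  decreases in \<open>m\<close> and equals \<open>7/2\<close> at \<open>m = 5\<close>.  Both the range \<open>\<nu> \<ge> 3\<close>, \<open>n \<ge> 1\<close> and the range
  \<open>\<nu> \<ge> 2\<close>, \<open>n \<ge> 2\<close> are covered.
\<close>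
lemma J3_term_Suc_le:
  assumes \<nu>: "\<nu> \<ge> 2" and m: "2 * real n + \<nu> \<ge> 5"
  shows "J3_term \<nu> (Suc n) \<le> 7 / (8 * (real n + 1) * (\<nu> + real n + 1)) * J3_term \<nu> n"
proof -
  define m where "m = 2 * real n + \<nu>"
  have m5: "m \<ge> 5" using m by (simp add: m_def)
  have "7 * ((m - 1) * (m - 2)) - 2 * ((m + 2) * (m + 1)) = (m - 5) * (5 * m - 2)"
    by (simp add: algebra_simps)
  moreover have "0 \<le> (m - 5) * (5 * m - 2)" using m5 by (intro mult_nonneg_nonneg) auto
  ultimately have "(m + 2) * (m + 1) \<le> 7 / 2 * ((m - 1) * (m - 2))" by linarith
  hence "m * ((m + 2) * (m + 1)) \<le> m * (7 / 2 * ((m - 1) * (m - 2)))"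
    using m5 by (intro mult_left_mono) auto
  moreover have "J3_num \<nu> (Suc n) = m * ((m + 2) * (m + 1))"
    by (simp add: J3_num_def m_def algebra_simps)
  moreover have "J3_num \<nu> n = m * ((m - 1) * (m - 2))"
    by (simp only: J3_num_def m_def mult.assoc)
  ultimately have num: "J3_num \<nu> (Suc n) \<le> 7 / 2 * J3_num \<nu> n"
    by (simp only: mult.left_commute)
  define P where "P = fact n * 4 ^ n * pochhammer \<nu> (Suc n)"
  have P: "P > 0" unfolding P_def using \<nu> by (intro mult_pos_pos pochhammer_pos) auto
  have "fact (Suc n) * 4 ^ Suc n * pochhammer \<nu> (Suc (Suc n)) = P * (4 * (real n + 1) * (\<nu> + real n + 1))"
    by (simp add: P_def pochhammer_Suc[of \<nu> "Suc n"] algebra_simps)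
  hence "J3_term \<nu> (Suc n) = J3_num \<nu> (Suc n) / (P * (4 * (real n + 1) * (\<nu> + real n + 1)))"
    by (simp only: J3_term_def)
  also have "\<dots> \<le> (7 / 2 * J3_num \<nu> n) / (P * (4 * (real n + 1) * (\<nu> + real n + 1)))"
    using P \<nu> by (intro divide_right_mono num) auto
  also have "\<dots> = 7 / (8 * (real n + 1) * (\<nu> + real n + 1)) * (J3_num \<nu> n / P)"
    using P \<nu> by (simp add: divide_simps)
  finally show ?thesis by (simp add: J3_term_def P_def)
qed

lemma abs_J3_coeff:
  assumes "\<nu> > 2"
  shows "\<bar>J3_coeff \<nu> n\<bar> = J3_term \<nu> n / ((\<nu> - 1) * (\<nu> - 2))"
  using assms J3_term_nonneg[of \<nu> n] by (simp add: J3_coeff_def abs_mult power_abs)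

lemma abs_J3_coeff_Suc_le:
  assumes \<nu>: "\<nu> > 2" and m: "2 * real n + \<nu> \<ge> 5"
  shows "\<bar>J3_coeff \<nu> (Suc n)\<bar> \<le> 7 / (8 * (real n + 1) * (\<nu> + real n + 1)) * \<bar>J3_coeff \<nu> n\<bar>"
proof -
  have "J3_term \<nu> (Suc n) / ((\<nu> - 1) * (\<nu> - 2)) \<le>
      7 / (8 * (real n + 1) * (\<nu> + real n + 1)) * J3_term \<nu> n / ((\<nu> - 1) * (\<nu> - 2))"
    using \<nu> m by (intro divide_right_mono J3_term_Suc_le) auto
  thus ?thesis unfolding abs_J3_coeff[OF \<nu>] by (simp only: times_divide_eq_right)
qed

text \<open>
  For \<open>\<nu> \<ge> 3\<close> the weighted tail is at most \<open>21/20 c \<cdot> 32/25 < 3/2 c\<close>: the quotient of its first term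
  and \<open>c\<close> is at most \<open>21/20\<close>, and its ratio at most \<open>7/32\<close>.
\<close>
lemma starlike_in_disk_normalized_bessel_J3:
  assumes \<nu>: "\<nu> \<ge> 3" and q1: "0 \<le> (\<Sum>n. real (Suc n) * J3_coeff \<nu> n)"
  shows "starlike_in_disk (normalized_bessel_J3 \<nu>)"
proof -
  have \<nu>2: "\<nu> > 2" using \<nu> by simp
  define c where "c = (\<nu> + 2) / (4 * ((\<nu> - 1) * (\<nu> - 2)))"
  define d where "d = (\<lambda>n. (real (n + 2))\<^sup>2 * (real (n + 3) * \<bar>J3_coeff \<nu> (n + 2)\<bar>))"
  have cpos: "c > 0" using \<nu> by (simp add: c_def)
  have "0 \<le> (\<nu> - 3) * (16 * \<nu> - 5)" using \<nu> by (intro mult_nonneg_nonneg) auto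
  hence "5 * (\<nu> + 2) < 16 * ((\<nu> - 1) * (\<nu> - 2))" using \<nu> by (simp add: algebra_simps)
  hence c: "c < 4 / 5" using \<nu> by (simp add: c_def divide_simps)
  have c1: "\<bar>J3_coeff \<nu> 1\<bar> = c" 
    unfolding J3_coeff_0_1(2)[OF \<nu>2] c_def[symmetric] abs_minus_cancel using cpos by (rule abs_of_pos)
  have d0: "d 0 \<le> 21 / 20 * c"
  proof -
    have "\<bar>J3_coeff \<nu> (Suc 1)\<bar> \<le> 7 / (8 * (real 1 + 1) * (\<nu> + real 1 + 1)) * \<bar>J3_coeff \<nu> 1\<bar>"
      using \<nu> by (intro abs_J3_coeff_Suc_le) auto
    also have "\<dots> \<le> 7 / 80 * c"
      unfolding c1 using \<nu> cpos by (intro mult_right_mono) (auto simp: divide_simps)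
    finally show ?thesis by (simp add: d_def numeral_2_eq_2)
  qed
  have dS: "d (Suc n) \<le> 7 / 32 * d n" for n
  proof -
    have "\<bar>J3_coeff \<nu> (Suc (n + 2))\<bar> \<le>
        7 / (8 * (real (n + 2) + 1) * (\<nu> + real (n + 2) + 1)) * \<bar>J3_coeff \<nu> (n + 2)\<bar>"
      using \<nu> by (intro abs_J3_coeff_Suc_le) auto
    also have "\<dots> \<le> 7 / (8 * (real n + 3) * (real n + 4)) * \<bar>J3_coeff \<nu> (n + 2)\<bar>"
      using \<nu> by (intro mult_right_mono divide_left_mono mult_mono mult_pos_pos) auto
    finally have "d (Suc n) \<le> (real n + 3)\<^sup>2 * ((real n + 4) * (7 / (8 * (real n + 3) * (real n + 4)) * \<bar>J3_coeff \<nu> (n + 2)\<bar>))"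
      unfolding d_def by (intro mult_mono) (auto simp: add_ac)
    also have "\<dots> = 7 / 8 * ((real n + 3) * \<bar>J3_coeff \<nu> (n + 2)\<bar>)"
      by (simp add: divide_simps power2_eq_square)
    also have "\<dots> \<le> 7 / 32 * (real (n + 2))\<^sup>2 * ((real n + 3) * \<bar>J3_coeff \<nu> (n + 2)\<bar>)"
      by (intro mult_right_mono) (auto simp: power2_eq_square algebra_simps)
    finally show ?thesis by (simp add: d_def add_ac)
  qed
  have dn: "d n \<ge> 0" for n by (simp add: d_def)
  have sd: "summable d" by (rule suminf_le_of_ratio(1)[of d "7 / 32"]) (use dn dS in auto)
  have "suminf d \<le> d 0 / (1 - 7 / 32)" by (rule suminf_le_of_ratio(2)[of d "7 / 32"]) (use dn dS in auto)
  hence D: "suminf d \<le> 3 / 2 * c" using d0 cpos by simp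
  show ?thesis
  proof (rule starlike_in_disk_power_series[OF normalized_bessel_J3_power_series(1)[OF \<nu>2] _ _ cpos c])
    show "J3_coeff \<nu> 0 = 1" "J3_coeff \<nu> 1 = - c"
      using J3_coeff_0_1[OF \<nu>2] by (auto simp: c_def)
  qed (use sd D q1 normalized_bessel_J3_power_series(2)[OF \<nu>2] in \<open>auto simp only: d_def\<close>)
qed

text \<open>
  Differentiating \<open>j + 1\<close> times multiplies the ratio of the coefficients of index \<open>n\<close> and \<open>n + 1\<close> by
  at most \<open>n + 2\<close>, and the coefficients that survive have index \<open>n \<ge> 1\<close>, where
  \<open>(n + 2) \<cdot> 7 / (8 (n + 1) (n + 4)) \<le> 21/80 < 1/2\<close>.
\<close>
lemma close_to_convex_deriv_normalized_bessel_J3: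
  assumes \<nu>: "\<nu> \<ge> 3" and j: "j \<ge> 1"
  shows "close_to_convex_in_disk ((deriv ^^ j) (normalized_bessel_J3 \<nu>))"
proof -
  have \<nu>2: "\<nu> > 2" using \<nu> by simp
  define b where "b = case_nat 0 (\<lambda>n. complex_of_real (J3_coeff \<nu> n))"
  have S: "(\<lambda>n. b n * z ^ n) sums normalized_bessel_J3 \<nu> z" for z
    unfolding b_def normalized_bessel_J3_power_series(2)[OF \<nu>2]
    by (rule sums_shifted_power_series) (rule normalized_bessel_J3_power_series(1)[OF \<nu>2])
  have f: "normalized_bessel_J3 \<nu> = (\<lambda>z. \<Sum>n. b n * z ^ n)"
    by (rule ext) (rule sums_unique[OF S])
  have g: "norm ((diffs ^^ Suc j) b m) = fact (m + Suc j) / fact m * \<bar>J3_coeff \<nu> (m + j)\<bar>" for m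
    unfolding diffs_funpow by (simp add: b_def norm_mult norm_divide del: fact_Suc)
  show ?thesis unfolding f
  proof (rule close_to_convex_in_disk_of_ratio[where k = "21 / 80"])
    show "summable (\<lambda>n. b n * y ^ n)" for y by (rule sums_summable[OF S])
    have "norm ((diffs ^^ Suc j) b 0) > 0"
      unfolding g abs_J3_coeff[OF \<nu>2] using J3_term_pos[OF \<nu>2] \<nu>2
      by (intro mult_pos_pos divide_pos_pos) auto
    thus "(diffs ^^ Suc j) b 0 \<noteq> 0" by (rule zero_less_norm_iff[THEN iffD1])
    fix m
    define n where "n = m + j"
    have n: "n \<ge> 1" using j by (simp add: n_def)
    have "(real n + 2) * (7 / (8 * (real n + 1) * (\<nu> + real n + 1))) \<le>
          (real n + 2) * (7 / (8 * (real n + 1) * (real n + 4)))"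
      using \<nu> by (intro mult_left_mono divide_left_mono mult_mono mult_pos_pos) auto
    also have "\<dots> \<le> 21 / 80"
    proof -
      have "0 \<le> (real n - 1) * (3 * real n + 8)" using n by (intro mult_nonneg_nonneg) auto
      hence "10 * (real n + 2) \<le> 3 * ((real n + 1) * (real n + 4))" by (simp add: algebra_simps)
      moreover have "(real n + 1) * (real n + 4) > 0" by (intro mult_pos_pos) auto
      ultimately have "7 * (real n + 2) / (8 * ((real n + 1) * (real n + 4))) \<le> 21 / 80"
        by (simp only: pos_divide_le_eq mult_pos_pos zero_less_numeral)
      thus ?thesis by (simp only: times_divide_eq_right mult.commute[of _ 7] mult.assoc)
    qed
    finally have k: "(real n + 2) * (7 / (8 * (real n + 1) * (\<nu> + real n + 1))) \<le> 21 / 80" .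
    have "fact (Suc m + Suc j) / fact (Suc m) = fact (m + Suc j) / fact m * ((real n + 2) / (real m + 1))"
      by (simp add: n_def add_ac mult_ac)
    also have "\<dots> \<le> fact (m + Suc j) / fact m * ((real n + 2) / 1)"
      by (intro mult_left_mono divide_left_mono) auto
    finally have F: "fact (Suc m + Suc j) / fact (Suc m) \<le> fact (m + Suc j) / fact m * (real n + 2)" by simp
    have "norm ((diffs ^^ Suc j) b (Suc m)) = fact (Suc m + Suc j) / fact (Suc m) * \<bar>J3_coeff \<nu> (Suc n)\<bar>"
      unfolding g n_def by (simp only: add_Suc)
    also have "\<dots> \<le> (fact (m + Suc j) / fact m * (real n + 2)) *
        (7 / (8 * (real n + 1) * (\<nu> + real n + 1)) * \<bar>J3_coeff \<nu> n\<bar>)"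
      using \<nu> n by (intro mult_mono F abs_J3_coeff_Suc_le) auto
    also have "\<dots> = ((real n + 2) * (7 / (8 * (real n + 1) * (\<nu> + real n + 1)))) * norm ((diffs ^^ Suc j) b m)"
      unfolding g n_def[symmetric] by (simp only: mult_ac)
    also have "\<dots> \<le> 21 / 80 * norm ((diffs ^^ Suc j) b m)"
      by (intro mult_right_mono k) auto
    finally show "norm ((diffs ^^ Suc j) b (Suc m)) \<le> 21 / 80 * norm ((diffs ^^ Suc j) b m)" .
  qed auto
qed

lemma starlike_normalized_bessel_J3_imp_nonneg:
  assumes \<nu>: "\<nu> > 2" and s: "starlike_in_disk (normalized_bessel_J3 \<nu>)"
  shows "0 \<le> (\<Sum>n. real (Suc n) * J3_coeff \<nu> n)"
proof (rule inj_on_disk_imp_deriv_at_one_nonneg)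
  note sa = normalized_bessel_J3_power_series(1)[OF \<nu>]
  have f: "normalized_bessel_J3 \<nu> = (\<lambda>z. z * (\<Sum>n. of_real (J3_coeff \<nu> n) * z ^ n))"
    by (rule ext) (rule normalized_bessel_J3_power_series(2)[OF \<nu>])
  show "inj_on (normalized_bessel_J3 \<nu>) (ball 0 1)" "normalized_bessel_J3 \<nu> holomorphic_on ball 0 1"
    using s by (auto simp: starlike_in_disk_def)
  show "real (Suc 0) * J3_coeff \<nu> 0 = 1" using J3_coeff_0_1(1)[OF \<nu>] by simp
  show "deriv (normalized_bessel_J3 \<nu>) z = (\<Sum>n. of_real (real (Suc n) * J3_coeff \<nu> n) * z ^ n)" for z
    unfolding f using DERIV_imp_deriv[OF deriv_shifted_power_series[OF sa]] by simp
  show "summable (\<lambda>n. complex_of_real (real (Suc n) * J3_coeff \<nu> n) * y ^ n)" for y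
  proof -
    have "summable (\<lambda>n. diffs (case_nat 0 (\<lambda>n. complex_of_real (J3_coeff \<nu> n))) n * y ^ n)"
      by (rule termdiff_converges_all) (rule sums_summable[OF sums_shifted_power_series[OF sa]])
    thus ?thesis by (simp add: diffs_def)
  qed
qed

section \<open>The slope at 1 and the Bessel equation\<close>

text \<open>
  The terms of the Bessel series at \<open>1\<close>, divided by \<open>2\<^sup>-\<^sup>\<nu> / \<Gamma>(\<nu>)\<close>.
\<close>
definition J_weight :: "real \<Rightarrow> nat \<Rightarrow> real" where
  "J_weight \<nu> n = (- 1) ^ n / (fact n * 4 ^ n * pochhammer \<nu> (Suc n))"

text \<open>
  The derivative of the normalized function at \<open>1\<close>, multiplied by \<open>(\<nu> - 1) (\<nu> - 2)\<close>.
\<close>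
definition J3_slope :: "real \<Rightarrow> real" where
  "J3_slope \<nu> = (\<Sum>n. (- 1) ^ n * (real (Suc n) * J3_term \<nu> n))"

lemma bessel_J_at_one:
  assumes \<nu>: "\<nu> > 0"
  shows "bessel_J \<nu> 1 = of_real ((1 / 2) powr \<nu> / Gamma \<nu> * (\<Sum>n. J_weight \<nu> n))"
    and "summable (J_weight \<nu>)"
proof -
  define k where "k = (1 / 2) powr \<nu> / Gamma \<nu>"
  have "Gamma \<nu> > 0" by (rule Gamma_real_pos[OF \<nu>])
  hence G0: "Gamma \<nu> \<noteq> 0" by linarith
  have k0: "k \<noteq> 0" using G0 by (simp add: k_def)
  have wt: "(- 1) ^ n / (fact n * Gamma (of_nat n + of_real \<nu> + 1)) * (1 / 4) ^ n * (1 / 2) powr of_real \<nu>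
        = complex_of_real (k * J_weight \<nu> n)" for n
  proof -
    have "\<nu> \<notin> \<int>\<^sub>\<le>\<^sub>0" using \<nu> by (auto elim!: nonpos_Ints_cases)
    hence "pochhammer \<nu> (Suc n) = Gamma (\<nu> + of_nat (Suc n)) / Gamma \<nu>" by (rule pochhammer_Gamma)
    hence G: "Gamma (real n + \<nu> + 1) = Gamma \<nu> * pochhammer \<nu> (Suc n)"
      using G0 by (simp add: add_ac)
    have "Gamma (of_nat n + of_real \<nu> + 1 :: complex) = of_real (Gamma (real n + \<nu> + 1))"
      by (simp flip: Gamma_complex_of_real)
    moreover have "(1 / 2 :: complex) powr of_real \<nu> = of_real ((1 / 2) powr \<nu>)"
      using powr_of_real[of "1 / 2" \<nu>] by simp
    ultimately have "(- 1) ^ n / (fact n * Gamma (of_nat n + of_real \<nu> + 1)) * (1 / 4) ^ n * (1 / 2) powr of_real \<nu>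
        = complex_of_real ((- 1) ^ n / (fact n * Gamma (real n + \<nu> + 1)) * (1 / 4) ^ n * (1 / 2) powr \<nu>)"
      by simp
    also have "(- 1) ^ n / (fact n * Gamma (real n + \<nu> + 1)) * (1 / 4) ^ n * (1 / 2) powr \<nu> = k * J_weight \<nu> n"
      unfolding G by (simp add: k_def J_weight_def power_divide mult_ac)
    finally show ?thesis .
  qed
  have "summable (\<lambda>n. complex_of_real (k * J_weight \<nu> n))"
    unfolding wt[symmetric] by (intro summable_mult2 summable_bessel_coeff \<nu>)
  hence "summable (\<lambda>n. k * J_weight \<nu> n)" by (subst (asm) summable_complex_of_real)
  thus sw: "summable (J_weight \<nu>)" using k0 by (simp add: summable_cmult_iff)
  have "bessel_J \<nu> 1 = (\<Sum>n. complex_of_real (k * J_weight \<nu> n))"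
    unfolding bessel_J_def wt[symmetric]
    by (intro suminf_cong) (simp add: powr_double_nat_add power_divide)
  also have "\<dots> = of_real (k * (\<Sum>n. J_weight \<nu> n))"
    by (simp only: suminf_of_real[OF summable_mult[OF sw], symmetric] suminf_mult[OF sw])
  finally show "bessel_J \<nu> 1 = of_real ((1 / 2) powr \<nu> / Gamma \<nu> * (\<Sum>n. J_weight \<nu> n))"
    by (simp only: k_def)
qed

lemma J_weight_Suc:
  assumes "\<nu> > 0"
  shows "4 * (real n + 1) * (\<nu> + real n + 1) * J_weight \<nu> (Suc n) = - J_weight \<nu> n"
proof -
  define P where "P = fact n * 4 ^ n * pochhammer \<nu> (Suc n)"
  have P: "P > 0" unfolding P_def using assms by (intro mult_pos_pos pochhammer_pos) auto
  have "fact (Suc n) * 4 ^ Suc n * pochhammer \<nu> (Suc (Suc n)) = P * (4 * (real n + 1) * (\<nu> + real n + 1))"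
    by (simp add: P_def pochhammer_Suc[of \<nu> "Suc n"] algebra_simps)
  hence "J_weight \<nu> (Suc n) = - ((- 1) ^ n / (P * (4 * (real n + 1) * (\<nu> + real n + 1))))"
    by (simp only: J_weight_def) simp
  moreover have "4 * (real n + 1) * (\<nu> + real n + 1) > 0" using assms by (intro mult_pos_pos) auto
  ultimately have "4 * (real n + 1) * (\<nu> + real n + 1) * J_weight \<nu> (Suc n) = - ((- 1) ^ n / P)"
    using P by (metis (no_types, opaque_lifting) less_irrefl mult.commute mult_minus_right
        nonzero_mult_divide_mult_cancel_left2 times_divide_eq_right)
  thus ?thesis by (simp only: J_weight_def P_def)
qed

text \<open>
  So the series of \<open>J\<^bsub>\<nu>+1\<^esub>(1)\<close> is, up to a factor, the first moment of the weights of order \<open>\<nu>\<close>.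
\<close>
lemma J_weight_plus_one:
  assumes "\<nu> > 0"
  shows "J_weight (\<nu> + 1) n = - 4 * \<nu> * (real (Suc n) * J_weight \<nu> (Suc n))"
proof -
  have "pochhammer \<nu> (Suc (Suc n)) = \<nu> * pochhammer (\<nu> + 1) (Suc n)" by (rule pochhammer_rec)
  hence "J_weight \<nu> (Suc n) = - ((- 1) ^ n / (real (Suc n) * fact n * (4 * 4 ^ n) * (\<nu> * pochhammer (\<nu> + 1) (Suc n))))"
    by (simp only: J_weight_def fact_Suc power_Suc)
  moreover have "real (Suc n) \<noteq> 0" by simp
  ultimately show ?thesis using assms by (simp add: J_weight_def)
qed

text \<open>
  The slope is a fourth-degree moment of the weights.  By the recurrence of the weights,
  \<open>n (n + \<nu>) r(n) w\<^sub>n + r(n + 1) w\<^sub>n / 4\<close> telescopes for every polynomial \<open>r\<close>, and this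
  reduces every moment to those of degree \<open>0\<close> and \<open>1\<close>, that is, to \<open>J\<^sub>\<nu>(1)\<close> and
  \<open>J\<^bsub>\<nu>+1\<^esub>(1)\<close>.
\<close>
lemma J3_slope_eq_J_weight_sums:
  assumes \<nu>: "\<nu> > 2"
  shows "J3_slope \<nu> = (2 * \<nu> ^ 3 - 7 * \<nu> ^ 2 + 3) / 2 * (\<Sum>n. J_weight \<nu> n)
           - (\<nu> ^ 3 + \<nu> ^ 2 + \<nu> - 1) * (\<Sum>n. real n * J_weight \<nu> n)"
    and "summable (\<lambda>n. real n * J_weight \<nu> n)"
proof -
  define w where "w = J_weight \<nu>"
  have sw: "summable w" unfolding w_def using \<nu> by (intro bessel_J_at_one) auto
  have "\<nu> + 1 > 0" using \<nu> by simp
  from bessel_J_at_one(2)[OF this] have "summable (\<lambda>n. - 4 * \<nu> * (real (Suc n) * w (Suc n)))"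
    using \<nu> unfolding w_def by (simp only: J_weight_plus_one[symmetric] eta_contract_eq)
  hence "summable (\<lambda>n. real (Suc n) * w (Suc n))" using \<nu> by (subst (asm) summable_cmult_iff) auto
  hence snw: "summable (\<lambda>n. real n * w n)" by (subst (asm) summable_Suc_iff)
  thus "summable (\<lambda>n. real n * J_weight \<nu> n)" by (simp only: w_def)
  have rec: "4 * (real n + 1) * (\<nu> + real n + 1) * w (Suc n) = - w n" for n
    unfolding w_def using \<nu> by (intro J_weight_Suc) auto
  have w0: "w \<longlonglongrightarrow> 0" by (rule summable_LIMSEQ_zero[OF sw])
  have nw0: "(\<lambda>n. real n * w n) \<longlonglongrightarrow> 0" by (rule summable_LIMSEQ_zero[OF snw])
  have "(\<lambda>n. (real (Suc n))\<^sup>2 * w (Suc n)) \<longlonglongrightarrow> 0"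
  proof (rule Lim_null_comparison[OF always_eventually])
    show "\<forall>n. norm ((real (Suc n))\<^sup>2 * w (Suc n)) \<le> \<bar>w n\<bar>"
    proof
      fix n
      have "(real (Suc n))\<^sup>2 * \<bar>w (Suc n)\<bar> \<le> 4 * (real n + 1) * (\<nu> + real n + 1) * \<bar>w (Suc n)\<bar>"
        using \<nu> by (intro mult_right_mono) (auto simp: power2_eq_square algebra_simps)
      also have "\<dots> = \<bar>4 * (real n + 1) * (\<nu> + real n + 1) * w (Suc n)\<bar>"
        using \<nu> by (simp add: abs_mult)
      finally show "norm ((real (Suc n))\<^sup>2 * w (Suc n)) \<le> \<bar>w n\<bar>"
        unfolding rec by (simp add: abs_mult)
    qed
    show "(\<lambda>n. \<bar>w n\<bar>) \<longlonglongrightarrow> 0" using w0 by (rule tendsto_rabs_zero)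
  qed
  hence nnw0: "(\<lambda>n. (real n)\<^sup>2 * w n) \<longlonglongrightarrow> 0" by (subst (asm) filterlim_sequentially_Suc)
  \<comment> \<open>the quotient in the division of \<open>(n + 1) (2n + \<nu>) (2n + \<nu> - 1) (2n + \<nu> - 2)\<close> by the operator
    \<open>r \<mapsto> n (n + \<nu>) r(n) + r(n + 1) / 4\<close>; the remainder \<open>A - B n\<close> is linear\<close>
  define r where "r = (\<lambda>x. 8 * x\<^sup>2 + (4 * \<nu> - 4) * x + (2 * \<nu>\<^sup>2 + 4 * \<nu> - 10))"
  define v where "v = (\<lambda>n. real n * (real n + \<nu>) * r (real n) * w n)"
  have vS: "v (Suc n) = - (r (real n + 1) * w n / 4)" for n
  proof -
    have "4 * v (Suc n) = r (real n + 1) * (4 * (real n + 1) * (\<nu> + real n + 1) * w (Suc n))"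
      by (simp add: v_def algebra_simps)
    thus ?thesis unfolding rec by simp
  qed
  have "(\<lambda>n. - ((8 * ((real n)\<^sup>2 * w n) + (4 * \<nu> + 12) * (real n * w n) + (2 * \<nu>\<^sup>2 + 8 * \<nu> - 6) * w n) / 4)) \<longlonglongrightarrow> - ((8 * 0 + (4 * \<nu> + 12) * 0 + (2 * \<nu>\<^sup>2 + 8 * \<nu> - 6) * 0) / 4)"
    by (intro tendsto_intros w0 nw0 nnw0) auto
  moreover have "v (Suc n) = - ((8 * ((real n)\<^sup>2 * w n) + (4 * \<nu> + 12) * (real n * w n) + (2 * \<nu>\<^sup>2 + 8 * \<nu> - 6) * w n) / 4)" for n
    unfolding vS r_def by (simp add: power2_eq_square algebra_simps)
  ultimately have "(\<lambda>n. v (Suc n)) \<longlonglongrightarrow> 0" by simp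
  hence "v \<longlonglongrightarrow> 0" by (subst (asm) filterlim_sequentially_Suc)
  from telescope_sums'[OF this] have tel: "(\<lambda>n. v n - v (Suc n)) sums 0" by (simp add: v_def)
  define A where "A = (2 * \<nu> ^ 3 - 7 * \<nu> ^ 2 + 3) / 2"
  define B where "B = \<nu> ^ 3 + \<nu> ^ 2 + \<nu> - 1"
  have "(\<lambda>n. A * w n - B * (real n * w n) + (v n - v (Suc n))) sums (A * suminf w - B * (\<Sum>n. real n * w n) + 0)"
    by (intro sums_add sums_diff sums_mult summable_sums sw snw tel)
  moreover have "A * w n - B * (real n * w n) + (v n - v (Suc n)) = (- 1) ^ n * (real (Suc n) * J3_term \<nu> n)" for n
  proof -
    have "A - B * real n + real n * (real n + \<nu>) * r (real n) + r (real n + 1) / 4 = real (Suc n) * J3_num \<nu> n"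
      by (simp add: A_def B_def r_def J3_num_def field_simps power2_eq_square power3_eq_cube)
    hence "(A - B * real n + real n * (real n + \<nu>) * r (real n) + r (real n + 1) / 4) * w n
        = real (Suc n) * J3_num \<nu> n * w n" by simp
    moreover have "real (Suc n) * J3_num \<nu> n * w n = (- 1) ^ n * (real (Suc n) * J3_term \<nu> n)"
      by (simp add: w_def J_weight_def J3_term_def)
    ultimately show ?thesis unfolding vS by (simp add: v_def algebra_simps)
  qed
  ultimately have "J3_slope \<nu> = A * suminf w - B * (\<Sum>n. real n * w n)"
    by (simp add: J3_slope_def sums_iff)
  thus "J3_slope \<nu> = (2 * \<nu> ^ 3 - 7 * \<nu> ^ 2 + 3) / 2 * (\<Sum>n. J_weight \<nu> n)
           - (\<nu> ^ 3 + \<nu> ^ 2 + \<nu> - 1) * (\<Sum>n. real n * J_weight \<nu> n)"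
    by (simp only: A_def B_def w_def)
qed

lemma bessel_root_eq_iff_slope:
  assumes \<nu>: "\<nu> > 2"
  shows "bessel_root_eq \<nu> \<longleftrightarrow> J3_slope \<nu> = 0"
proof -
  define k where "k = (1 / 2) powr \<nu> / Gamma \<nu>"
  define S0 where "S0 = (\<Sum>n. J_weight \<nu> n)"
  define S1 where "S1 = (\<Sum>n. real n * J_weight \<nu> n)"
  have "Gamma \<nu> > 0" using \<nu> by (intro Gamma_real_pos) auto
  hence k0: "k \<noteq> 0" by (simp add: k_def)
  have s1: "summable (\<lambda>n. real n * J_weight \<nu> n)" by (rule J3_slope_eq_J_weight_sums(2)[OF \<nu>])
  have J0: "bessel_J \<nu> 1 = of_real (k * S0)"
    unfolding k_def S0_def using \<nu> by (intro bessel_J_at_one) auto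
  have "(\<Sum>n. J_weight (\<nu> + 1) n) = (\<Sum>n. - 4 * \<nu> * (real (Suc n) * J_weight \<nu> (Suc n)))"
    using \<nu> by (intro suminf_cong J_weight_plus_one) auto
  also have "\<dots> = - 4 * \<nu> * (\<Sum>n. real (Suc n) * J_weight \<nu> (Suc n))"
    by (rule suminf_mult) (use s1 in \<open>simp only: summable_Suc_iff[of "\<lambda>n. real n * J_weight \<nu> n"]\<close>)
  also have "(\<Sum>n. real (Suc n) * J_weight \<nu> (Suc n)) = S1"
    using suminf_split_head[OF s1] by (simp add: S1_def)
  finally have W: "(\<Sum>n. J_weight (\<nu> + 1) n) = - 4 * \<nu> * S1" .
  have "(1 / 2) powr (\<nu> + 1) / Gamma (\<nu> + 1) = k / (2 * \<nu>)"
  proof -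
    have "\<nu> \<notin> \<int>\<^sub>\<le>\<^sub>0" using \<nu> by (auto elim!: nonpos_Ints_cases)
    hence "Gamma (\<nu> + 1) = \<nu> * Gamma \<nu>" by (rule Gamma_plus1)
    thus ?thesis by (simp add: k_def powr_add)
  qed
  moreover have "bessel_J (\<nu> + 1) 1 = of_real ((1 / 2) powr (\<nu> + 1) / Gamma (\<nu> + 1) * (\<Sum>n. J_weight (\<nu> + 1) n))"
    using \<nu> by (intro bessel_J_at_one) auto
  ultimately have "bessel_J (\<nu> + 1) 1 = of_real (k / (2 * \<nu>) * (- 4 * \<nu> * S1))"
    unfolding W by simp
  also have "k / (2 * \<nu>) * (- 4 * \<nu> * S1) = - 2 * k * S1" using \<nu> by simp
  finally have J1: "bessel_J (\<nu> + 1) 1 = of_real (- 2 * k * S1)" .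
  have "of_real (2 * \<nu> ^ 3 - 7 * \<nu> ^ 2 + 3) * bessel_J \<nu> 1
     + of_real (\<nu> ^ 3 + \<nu> ^ 2 + \<nu> - 1) * bessel_J (\<nu> + 1) 1 =
     complex_of_real ((2 * \<nu> ^ 3 - 7 * \<nu> ^ 2 + 3) * (k * S0) + (\<nu> ^ 3 + \<nu> ^ 2 + \<nu> - 1) * (- 2 * k * S1))"
    unfolding J0 J1 by (simp only: of_real_add of_real_mult)
  also have "(2 * \<nu> ^ 3 - 7 * \<nu> ^ 2 + 3) * (k * S0) + (\<nu> ^ 3 + \<nu> ^ 2 + \<nu> - 1) * (- 2 * k * S1) = 2 * k * J3_slope \<nu>"
    unfolding J3_slope_eq_J_weight_sums(1)[OF \<nu>] S0_def[symmetric] S1_def[symmetric]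
    by (simp add: field_simps)
  finally show ?thesis unfolding bessel_root_eq_def using k0 by simp
qed

section \<open>The sign of the slope as a function of the order\<close>

text \<open>
  Each quotient \<open>(2n + \<nu> - i) / (n + \<nu> - i)\<close> decreases in \<open>\<nu>\<close>; the three factors
  \<open>n + \<nu> - i\<close> are taken from the Pochhammer symbol, which has them once \<open>n \<ge> 2\<close>.
\<close>
lemma J3_term_antimono:
  assumes x: "2 \<le> x" and xy: "x \<le> y" and n: "n \<ge> 2"
  shows "J3_term y n \<le> J3_term x n"
proof -
  obtain k where k: "n = k + 2" using n by (metis le_add_diff_inverse2)
  have split: "pochhammer z (Suc n) = pochhammer z k * ((z + real n) * (z + real n - 1) * (z + real n - 2))" for z :: real
    by (simp add: k pochhammer_Suc algebra_simps)
  have A: "(2 * real n + y - i) * (x + real n - i) \<le> (2 * real n + x - i) * (y + real n - i)" for i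
    using mult_left_mono[OF xy, of "real n"] by (simp add: algebra_simps)
  have pm: "pochhammer x k \<le> pochhammer y k" for k
    by (induction k) (use x xy in \<open>auto simp: pochhammer_Suc intro!: mult_mono pochhammer_nonneg\<close>)
  have n2: "real n \<ge> 2" using n by simp
  have "J3_num y n * pochhammer x (Suc n) =
      ((2 * real n + y - 0) * (x + real n - 0)) * ((2 * real n + y - 1) * (x + real n - 1)) *
      ((2 * real n + y - 2) * (x + real n - 2)) * pochhammer x k"
    by (simp add: split J3_num_def)
  also have "\<dots> \<le> ((2 * real n + x - 0) * (y + real n - 0)) * ((2 * real n + x - 1) * (y + real n - 1)) *
      ((2 * real n + x - 2) * (y + real n - 2)) * pochhammer y k"
    using x xy n2 by (intro mult_mono A pm mult_nonneg_nonneg pochhammer_nonneg) auto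
  also have "\<dots> = J3_num x n * pochhammer y (Suc n)"
    by (simp add: split J3_num_def)
  finally have main: "J3_num y n * pochhammer x (Suc n) \<le> J3_num x n * pochhammer y (Suc n)" .
  have "pochhammer x (Suc n) > 0" "pochhammer y (Suc n) > 0" using x xy by (auto intro!: pochhammer_pos)
  hence "J3_num y n / pochhammer y (Suc n) \<le> J3_num x n / pochhammer x (Suc n)"
    using main by (simp add: frac_le_eq divide_le_eq pos_le_divide_eq mult.commute)
  hence "J3_num y n / pochhammer y (Suc n) / (fact n * 4 ^ n) \<le> J3_num x n / pochhammer x (Suc n) / (fact n * 4 ^ n)"
    by (intro divide_right_mono) auto
  thus ?thesis by (simp only: J3_term_def divide_divide_eq_left mult.commute)
qed

text \<open>
  The numerator increases in \<open>\<nu>\<close> and each of the \<open>n + 1\<close> factors of the Pochhammer symbol grows at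
  most by the factor \<open>y/x\<close>, so the term shrinks at most by \<open>(x/y)\<^sup>n\<^sup>+\<^sup>1\<close>, which Bernoulli's
  inequality linearizes.
\<close>
lemma J3_term_diff_le:
  assumes x: "2 \<le> x" and xy: "x \<le> y" and n: "n \<ge> 2"
  shows "J3_term x n - J3_term y n \<le> real (Suc n) / 2 * (y - x) * J3_term 2 n"
proof -
  define F where "F = (fact n * 4 ^ n :: real)"
  have F: "F > 0" by (simp add: F_def)
  have px: "pochhammer x (Suc n) > 0" and py: "pochhammer y (Suc n) > 0" using x xy by (auto intro!: pochhammer_pos)
  have p: "(x / y) ^ m * pochhammer y m \<le> pochhammer x m" for m
  proof (induction m)
    case (Suc m)
    have "x / y * (y + real m) \<le> x + real m"
      using x xy mult_right_mono[OF xy, of "real m"] by (simp add: field_simps)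
    hence "((x / y) ^ m * pochhammer y m) * (x / y * (y + real m)) \<le> pochhammer x m * (x + real m)"
      using x xy by (intro mult_mono Suc pochhammer_nonneg) auto
    thus ?case by (simp only: pochhammer_Suc power_Suc mult_ac)
  qed simp
  have num: "J3_num x n \<le> J3_num y n"
    unfolding J3_num_def using x xy by (intro mult_mono mult_nonneg_nonneg) auto
  have "(x / y) ^ Suc n * J3_term x n = (x / y) ^ Suc n * J3_num x n / (F * pochhammer x (Suc n))"
    by (simp add: J3_term_def F_def)
  also have "\<dots> \<le> J3_num y n / (F * pochhammer y (Suc n))"
  proof -
    have "(x / y) ^ Suc n * pochhammer y (Suc n) * J3_num x n \<le> pochhammer x (Suc n) * J3_num y n"
      using x xy by (intro mult_mono p num J3_num_nonneg pochhammer_nonneg) auto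
    hence "F * ((x / y) ^ Suc n * pochhammer y (Suc n) * J3_num x n) \<le> F * (pochhammer x (Suc n) * J3_num y n)"
      using F by (intro mult_left_mono) auto
    moreover have X: "F * pochhammer x (Suc n) > 0" and Y: "F * pochhammer y (Suc n) > 0" using F px py by auto
    ultimately show ?thesis
      unfolding pos_le_divide_eq[OF Y] times_divide_eq_left pos_divide_le_eq[OF X] by (simp only: mult_ac)
  qed
  also have "\<dots> = J3_term y n" by (simp add: J3_term_def F_def)
  finally have low: "(x / y) ^ Suc n * J3_term x n \<le> J3_term y n" .
  have "1 + real (Suc n) * (x / y - 1) \<le> (1 + (x / y - 1)) ^ Suc n"
    using x xy by (intro Bernoulli_inequality) auto
  hence B: "1 - real (Suc n) * (1 - x / y) \<le> (x / y) ^ Suc n" by (simp add: algebra_simps)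
  have t0: "J3_term x n \<ge> 0" by (rule J3_term_nonneg[OF x])
  from mult_right_mono[OF B t0] low
  have "J3_term x n - J3_term y n \<le> real (Suc n) * (1 - x / y) * J3_term x n"
    by (simp add: left_diff_distrib)
  also have "\<dots> \<le> real (Suc n) * ((y - x) / 2) * J3_term 2 n"
  proof (intro mult_mono mult_nonneg_nonneg t0)
    have "1 - x / y = (y - x) / y" using x xy by (simp add: field_simps)
    also have "\<dots> \<le> (y - x) / 2" using x xy by (intro divide_left_mono) auto
    finally show "1 - x / y \<le> (y - x) / 2" .
    show "J3_term x n \<le> J3_term 2 n" by (rule J3_term_antimono[OF _ x n]) simp
  qed (use x xy in auto)
  finally show ?thesis by simp
qed

lemma J3_term_ratio:
  assumes \<nu>: "\<nu> \<ge> 2" and n: "n \<ge> 2"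
  shows "(real n + 2) * J3_term \<nu> (Suc n) \<le> 1 / 4 * ((real n + 1) * J3_term \<nu> n)"
    and "(real n + 2)\<^sup>2 * J3_term \<nu> (Suc n) \<le> 1 / 4 * ((real n + 1)\<^sup>2 * J3_term \<nu> n)"
proof -
  have n2: "real n \<ge> 2" using n by simp
  have S: "J3_term \<nu> (Suc n) \<le> 7 / (8 * (real n + 1) * (\<nu> + real n + 1)) * J3_term \<nu> n"
    using \<nu> n2 by (intro J3_term_Suc_le) auto
  also have "\<dots> \<le> 7 / (8 * (real n + 1) * 5) * J3_term \<nu> n"
    using \<nu> n2 by (intro mult_right_mono divide_left_mono mult_left_mono mult_pos_pos J3_term_nonneg) auto
  finally have "(real n + 1) * J3_term \<nu> (Suc n) \<le> (real n + 1) * (7 / (8 * (real n + 1) * 5) * J3_term \<nu> n)"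
    by (intro mult_left_mono) auto
  also have "\<dots> = 7 / 40 * J3_term \<nu> n" by (simp add: field_simps)
  finally have S: "(real n + 1) * J3_term \<nu> (Suc n) \<le> 7 / 40 * J3_term \<nu> n" .
  have t: "J3_term \<nu> n \<ge> 0" "J3_term \<nu> (Suc n) \<ge> 0" using J3_term_nonneg[OF \<nu>] by auto
  have le2: "(real n + 2) * J3_term \<nu> (Suc n) \<le> 7 / 30 * J3_term \<nu> n"
  proof -
    have "(real n + 2) * J3_term \<nu> (Suc n) \<le> 4 / 3 * (real n + 1) * J3_term \<nu> (Suc n)"
      using n2 t by (intro mult_right_mono) auto
    also have "\<dots> = 4 / 3 * ((real n + 1) * J3_term \<nu> (Suc n))" by simp
    also have "\<dots> \<le> 4 / 3 * (7 / 40 * J3_term \<nu> n)" by (intro mult_left_mono S) auto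
    finally show ?thesis by simp
  qed
  also have "\<dots> \<le> 1 / 4 * (real n + 1) * J3_term \<nu> n" using n2 t by (intro mult_right_mono) auto
  finally show "(real n + 2) * J3_term \<nu> (Suc n) \<le> 1 / 4 * ((real n + 1) * J3_term \<nu> n)" by simp
  have "(real n + 2)\<^sup>2 * J3_term \<nu> (Suc n) = (real n + 2) * ((real n + 2) * J3_term \<nu> (Suc n))"
    by (simp add: power2_eq_square)
  also have "\<dots> \<le> (real n + 2) * (7 / 30 * J3_term \<nu> n)" by (intro mult_left_mono le2) auto
  also have "\<dots> = 7 / 30 * (real n + 2) * J3_term \<nu> n" by simp
  also have "\<dots> \<le> 1 / 4 * (real n + 1)\<^sup>2 * J3_term \<nu> n"
  proof (intro mult_right_mono t)
    have "2 * (real n + 2) \<le> (real n + 1)\<^sup>2" using n2 mult_mono[OF n2 n2] by (simp add: power2_eq_square algebra_simps)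
    thus "7 / 30 * (real n + 2) \<le> 1 / 4 * (real n + 1)\<^sup>2" using n2 by simp
  qed
  finally show "(real n + 2)\<^sup>2 * J3_term \<nu> (Suc n) \<le> 1 / 4 * ((real n + 1)\<^sup>2 * J3_term \<nu> n)" by simp
qed

text \<open>
  The part of the slope with \<open>n \<ge> 3\<close>; the first three terms are kept explicit because they
  dominate and have to be known precisely.
\<close>
definition J3_tail :: "real \<Rightarrow> real" where
  "J3_tail \<nu> = (\<Sum>n. (- 1) ^ (n + 3) * (real (n + 4) * J3_term \<nu> (n + 3)))"

lemma summable_J3_tail:
  assumes \<nu>: "\<nu> \<ge> 2"
  shows "summable (\<lambda>n. real (n + 4) * J3_term \<nu> (n + 3))"
    and "summable (\<lambda>n. (- 1) ^ (n + 3) * (real (n + 4) * J3_term \<nu> (n + 3)))"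
proof -
  show s: "summable (\<lambda>n. real (n + 4) * J3_term \<nu> (n + 3))"
  proof (rule suminf_le_of_ratio(1)[where k = "1 / 4"])
    fix n
    show "real (Suc n + 4) * J3_term \<nu> (Suc n + 3) \<le> 1 / 4 * (real (n + 4) * J3_term \<nu> (n + 3))"
      using J3_term_ratio(1)[OF \<nu>, of "n + 3"] by (simp add: add_ac)
    show "0 \<le> real (n + 4) * J3_term \<nu> (n + 3)" using J3_term_nonneg[OF \<nu>] by simp
  qed auto
  show "summable (\<lambda>n. (- 1) ^ (n + 3) * (real (n + 4) * J3_term \<nu> (n + 3)))"
    by (rule summable_comparison_test'[OF s]) (use J3_term_nonneg[OF \<nu>] in \<open>simp add: abs_mult power_abs\<close>)
qed

lemma J3_slope_split:
  assumes \<nu>: "\<nu> \<ge> 2"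
  shows "J3_slope \<nu> = (\<nu> - 1) * (\<nu> - 2) - (\<nu> + 2) / 2
           + 3 * ((\<nu> + 4) * (\<nu> + 3) / (32 * \<nu> * (\<nu> + 1))) + J3_tail \<nu>"
    and "summable (\<lambda>n. (- 1) ^ n * (real (Suc n) * J3_term \<nu> n))"
proof -
  define u where "u = (\<lambda>n. (- 1) ^ n * (real (Suc n) * J3_term \<nu> n))"
  have eq: "u (n + 3) = (- 1) ^ (n + 3) * (real (n + 4) * J3_term \<nu> (n + 3))" for n
    by (simp add: u_def)
  have "summable (\<lambda>n. u (n + 3))" unfolding eq by (rule summable_J3_tail(2)[OF \<nu>])
  hence su: "summable u" by (subst (asm) summable_iff_shift)
  thus "summable (\<lambda>n. (- 1) ^ n * (real (Suc n) * J3_term \<nu> n))" by (simp only: u_def)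
  have "J3_slope \<nu> = suminf u" by (simp only: J3_slope_def u_def)
  also have "\<dots> = (\<Sum>n. u (n + 3)) + (\<Sum>n<3. u n)" by (rule suminf_split_initial_segment[OF su])
  also have "(\<Sum>n. u (n + 3)) = J3_tail \<nu>" unfolding eq J3_tail_def ..
  also have "(\<Sum>n<3. u n) = J3_term \<nu> 0 - 2 * J3_term \<nu> 1 + 3 * J3_term \<nu> 2"
    by (simp add: u_def eval_nat_numeral)
  finally show "J3_slope \<nu> = (\<nu> - 1) * (\<nu> - 2) - (\<nu> + 2) / 2
           + 3 * ((\<nu> + 4) * (\<nu> + 3) / (32 * \<nu> * (\<nu> + 1))) + J3_tail \<nu>"
    using \<nu> by (simp only: J3_term_explicit[of \<nu>])
qed

text \<open>
  The constant bounds \<open>1/2\<close> times the sum of \<open>(n + 1)\<^sup>2\<close> times the terms at \<open>\<nu> = 2\<close>, whose first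
  summand (\<open>n = 3\<close>) is \<open>7/60\<close> and whose ratio is at most \<open>1/4\<close>.
\<close>
lemma J3_tail_lipschitz:
  assumes x: "2 \<le> x" and xy: "x \<le> y"
  shows "\<bar>J3_tail x - J3_tail y\<bar> \<le> 7 / 90 * (y - x)"
proof -
  have y: "2 \<le> y" using x xy by simp
  define L where "L = (\<lambda>n. (real n + 4)\<^sup>2 * J3_term 2 (n + 3))"
  have L: "summable L" "suminf L \<le> L 0 / (1 - 1 / 4)"
  proof -
    have a: "0 \<le> L n" "L (Suc n) \<le> 1 / 4 * L n" for n
      using J3_term_ratio(2)[of 2 "n + 3"] J3_term_nonneg[of 2 "n + 3"] by (simp_all add: L_def add_ac)
    show "summable L" "suminf L \<le> L 0 / (1 - 1 / 4)"
      by (rule suminf_le_of_ratio[of L "1 / 4"]; use a in simp)+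
  qed
  have "L 0 = 7 / 60" using J3_term_explicit(4)[of 2] by (simp add: L_def)
  hence L': "suminf L \<le> 7 / 45" using L(2) by simp
  define u where "u = (\<lambda>z n. (- 1) ^ (n + 3) * (real (n + 4) * J3_term z (n + 3)))"
  have "J3_tail x - J3_tail y = (\<Sum>n. u x n - u y n)"
    unfolding J3_tail_def u_def by (rule suminf_diff; rule summable_J3_tail(2)) (use x y in auto)
  also have "\<bar>\<dots>\<bar> \<le> (\<Sum>n. (y - x) / 2 * L n)"
    unfolding real_norm_def[symmetric]
  proof (rule norm_suminf_le)
    fix n
    have "u x n - u y n = (- 1) ^ (n + 3) * (real (n + 4) * (J3_term x (n + 3) - J3_term y (n + 3)))"
      by (simp add: u_def algebra_simps)
    hence "norm (u x n - u y n) = real (n + 4) * \<bar>J3_term x (n + 3) - J3_term y (n + 3)\<bar>"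
      by (simp add: abs_mult power_abs)
    also have "\<bar>J3_term x (n + 3) - J3_term y (n + 3)\<bar> = J3_term x (n + 3) - J3_term y (n + 3)"
      using J3_term_antimono[OF x xy, of "n + 3"] by simp
    also have "real (n + 4) * (J3_term x (n + 3) - J3_term y (n + 3)) \<le>
        real (n + 4) * (real (Suc (n + 3)) / 2 * (y - x) * J3_term 2 (n + 3))"
      by (intro mult_left_mono J3_term_diff_le x xy) auto
    also have "\<dots> = (y - x) / 2 * L n" by (simp add: L_def power2_eq_square field_simps)
    finally show "norm (u x n - u y n) \<le> (y - x) / 2 * L n" .
  qed (intro summable_mult L)
  also have "\<dots> = (y - x) / 2 * suminf L" by (rule suminf_mult[OF L(1)])
  also have "\<dots> \<le> (y - x) / 2 * (7 / 45)" using xy by (intro mult_left_mono L') auto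
  finally show ?thesis by simp
qed

text \<open>
  The tail lies within a third of its leading term \<open>- 4 J3_term \<nu> 3\<close>.
\<close>
lemma J3_tail_bounds:
  assumes \<nu>: "\<nu> \<ge> 2"
  shows "- (16 / 3 * J3_term \<nu> 3) \<le> J3_tail \<nu>" and "J3_tail \<nu> \<le> - (8 / 3 * J3_term \<nu> 3)"
proof -
  define d where "d = (\<lambda>n. real (n + 5) * J3_term \<nu> (n + 4))"
  define u where "u = (\<lambda>n. (- 1) ^ (n + 3) * (real (n + 4) * J3_term \<nu> (n + 3)))"
  have d: "0 \<le> d n" "d (Suc n) \<le> 1 / 4 * d n" for n
    using J3_term_ratio(1)[OF \<nu>, of "n + 4"] J3_term_nonneg[OF \<nu>, of "n + 4"] by (simp_all add: d_def add_ac)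
  have sd: "summable d" "suminf d \<le> d 0 / (1 - 1 / 4)"
    by (rule suminf_le_of_ratio[of d "1 / 4"]; use d in simp)+
  have "d 0 \<le> J3_term \<nu> 3"
    using J3_term_ratio(1)[OF \<nu>, of 3] by (simp add: d_def)
  hence sd': "suminf d \<le> 4 / 3 * J3_term \<nu> 3" using sd(2) by simp
  have "norm (\<Sum>n. u (Suc n)) \<le> suminf d"
    by (rule norm_suminf_le[OF _ sd(1)])
       (use J3_term_nonneg[OF \<nu>] in \<open>simp add: u_def d_def abs_mult power_abs add_ac\<close>)
  moreover have "J3_tail \<nu> = u 0 + (\<Sum>n. u (Suc n))"
    using suminf_split_head[OF summable_J3_tail(2)[OF \<nu>]] by (simp add: u_def J3_tail_def)
  moreover have "u 0 = - (4 * J3_term \<nu> 3)" by (simp add: u_def)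
  ultimately show "- (16 / 3 * J3_term \<nu> 3) \<le> J3_tail \<nu>" "J3_tail \<nu> \<le> - (8 / 3 * J3_term \<nu> 3)"
    using sd' by (simp_all add: abs_le_iff)
qed

text \<open>
  The quadratic part gains at least \<open>(y - x)/2\<close>, the term \<open>n = 2\<close> loses at most \<open>9/32 (y - x)\<close>
  and the tail at most \<open>7/90 (y - x)\<close>.
\<close>
lemma J3_slope_strict_mono:
  assumes x: "2 \<le> x" and xy: "x < y"
  shows "J3_slope x < J3_slope y"
proof -
  have y: "2 \<le> y" using x xy by simp
  define q where "q = (\<lambda>z::real. (z - 1) * (z - 2) - (z + 2) / 2)"
  \<comment> \<open>the variable part of the partial fraction decomposition of the term \<open>n = 2\<close>\<close>
  define p where "p = (\<lambda>z::real. 2 / z - 1 / (z + 1))"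
  have slope: "J3_slope z = q z + (3 / 32 + 9 / 16 * p z) + J3_tail z" if z: "2 \<le> z" for z
  proof -
    have "z \<noteq> 0" "z + 1 \<noteq> 0" using z by auto
    hence "3 * ((z + 4) * (z + 3) / (32 * z * (z + 1))) = 3 / 32 + 9 / 16 * p z"
      by (simp add: p_def divide_simps) (simp add: algebra_simps)
    thus ?thesis unfolding J3_slope_split(1)[OF z] q_def by (simp only:)
  qed
  have "q y - q x = (y - x) * (x + y - 7 / 2)" by (simp add: q_def field_simps)
  also have "\<dots> \<ge> (y - x) * (1 / 2)" using x xy by (intro mult_left_mono) auto
  finally have q: "q y - q x \<ge> (y - x) / 2" by simp
  have "2 * 2 \<le> x * y" using x y by (intro mult_mono) auto
  hence "2 / (x * y) \<le> 1 / 2" using x y by (simp add: divide_simps)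
  hence "(y - x) * (2 / (x * y)) \<le> (y - x) * (1 / 2)" using xy by (intro mult_left_mono) auto
  moreover have "2 / x - 2 / y = (y - x) * (2 / (x * y))" using x y by (simp add: field_simps)
  ultimately have "2 / x - 2 / y \<le> (y - x) * (1 / 2)" by (simp only:)
  moreover have "1 / (y + 1) \<le> 1 / (x + 1)" using x xy by (intro divide_left_mono) auto
  ultimately have "(2 / x - 2 / y) + (1 / (y + 1) - 1 / (x + 1)) \<le> (y - x) * (1 / 2) + 0"
    by (intro add_mono) (simp_all only: diff_le_0_iff_le)
  hence p: "p x - p y \<le> (y - x) / 2" by (simp add: p_def algebra_simps)
  have "\<bar>J3_tail x - J3_tail y\<bar> \<le> 7 / 90 * (y - x)" using x xy by (intro J3_tail_lipschitz) auto
  hence "J3_tail x - J3_tail y \<le> 7 / 90 * (y - x)" by (rule order_trans[OF abs_ge_self])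
  with q p xy show ?thesis unfolding slope[OF x] slope[OF y] by (simp add: field_simps)
qed

lemma continuous_on_J3_slope: "continuous_on {2..} J3_slope"
proof -
  have "(7 / 90)-lipschitz_on {2..} J3_tail"
  proof (rule lipschitz_onI)
    fix x y :: real assume "x \<in> {2..}" "y \<in> {2..}"
    thus "dist (J3_tail x) (J3_tail y) \<le> 7 / 90 * dist x y"
      using J3_tail_lipschitz[of x y] J3_tail_lipschitz[of y x]
      by (cases "x \<le> y") (auto simp: dist_real_def abs_minus_commute)
  qed simp
  hence "continuous_on {2..} J3_tail" by (rule lipschitz_on_continuous_on)
  hence "continuous_on {2..} (\<lambda>\<nu>. (\<nu> - 1) * (\<nu> - 2) - (\<nu> + 2) / 2
           + 3 * ((\<nu> + 4) * (\<nu> + 3) / (32 * \<nu> * (\<nu> + 1))) + J3_tail \<nu>)"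
    by (intro continuous_intros) auto
  thus ?thesis by (rule continuous_on_cong[THEN iffD1, rotated 2]) (auto simp: J3_slope_split)
qed

text \<open>
  The constant \<open>1/286\<close> separates the two values of the term \<open>n = 3\<close>.
\<close>
lemma J3_slope_sign_change:
  shows "J3_slope (384 / 125) < 0" and "J3_slope (1541 / 500) > 0"
proof -
  have "J3_term (384 / 125) 3 \<ge> 1 / 286"
    using J3_term_explicit(4)[of "384 / 125"] by simp
  thus "J3_slope (384 / 125) < 0"
    using J3_tail_bounds(2)[of "384 / 125"] by (simp add: J3_slope_split)
  have "J3_term (1541 / 500) 3 \<le> 1 / 286"
    using J3_term_explicit(4)[of "1541 / 500"] by simp
  thus "J3_slope (1541 / 500) > 0"
    using J3_tail_bounds(1)[of "1541 / 500"] by (simp add: J3_slope_split)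
qed

lemma suminf_deriv_coeff_eq_slope:
  assumes \<nu>: "\<nu> > 2"
  shows "(\<Sum>n. real (Suc n) * J3_coeff \<nu> n) = J3_slope \<nu> / ((\<nu> - 1) * (\<nu> - 2))"
proof -
  have "(\<Sum>n. (- 1) ^ n * (real (Suc n) * J3_term \<nu> n) / ((\<nu> - 1) * (\<nu> - 2))) = J3_slope \<nu> / ((\<nu> - 1) * (\<nu> - 2))"
    unfolding J3_slope_def using \<nu> by (intro suminf_divide J3_slope_split) auto
  moreover have "(- 1) ^ n * (real (Suc n) * J3_term \<nu> n) / ((\<nu> - 1) * (\<nu> - 2)) = real (Suc n) * J3_coeff \<nu> n" for n
    by (simp only: J3_coeff_def times_divide_eq_right mult.left_commute)
  ultimately show ?thesis by simp
qed

theorem theorem5: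
  shows "\<exists>\<nu>s::real. \<nu>s > 2 \<and> bessel_root_eq \<nu>s \<and> (\<forall>\<mu>>2. bessel_root_eq \<mu> \<longrightarrow> \<mu> = \<nu>s) \<and>
           \<bar>\<nu>s - 3.077\<bar> < 0.005 \<and>
           (\<forall>\<nu>>2.
              ((starlike_in_disk (normalized_bessel_J3 \<nu>) \<and>
                (\<forall>n\<ge>1. close_to_convex_in_disk ((deriv ^^ n) (normalized_bessel_J3 \<nu>))))
               \<longleftrightarrow> \<nu> \<ge> \<nu>s) \<and>
              (\<forall>n\<ge>1. close_to_convex_in_disk ((deriv ^^ n) (normalized_bessel_J3 \<nu>)) \<longrightarrow>
                     inj_on ((deriv ^^ n) (normalized_bessel_J3 \<nu>)) (ball 0 1)))"
proof -
  have "continuous_on {384 / 125..1541 / 500} J3_slope"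
    by (rule continuous_on_subset[OF continuous_on_J3_slope]) auto
  then obtain \<nu>s where \<nu>s: "384 / 125 \<le> \<nu>s" "\<nu>s \<le> 1541 / 500" "J3_slope \<nu>s = 0"
    using IVT'[of J3_slope "384 / 125" 0 "1541 / 500"] J3_slope_sign_change by auto
  have "\<nu>s \<noteq> 384 / 125" "\<nu>s \<noteq> 1541 / 500" 
    using \<nu>s(3) J3_slope_sign_change by (metis less_irrefl)+
  hence strict: "384 / 125 < \<nu>s" "\<nu>s < 1541 / 500" using \<nu>s(1,2) by linarith+
  have \<nu>s2: "\<nu>s > 2" using \<nu>s by simp
  have sign: "J3_slope \<nu> \<ge> 0 \<longleftrightarrow> \<nu> \<ge> \<nu>s" "J3_slope \<nu> = 0 \<longleftrightarrow> \<nu> = \<nu>s" if "\<nu> > 2" for \<nu>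
    using J3_slope_strict_mono[of \<nu> \<nu>s] J3_slope_strict_mono[of \<nu>s \<nu>] that \<nu>s2 \<nu>s(3)
    by (cases \<nu> \<nu>s rule: linorder_cases; simp)+
  show ?thesis
  proof (intro exI[of _ \<nu>s] conjI allI impI)
    show "bessel_root_eq \<nu>s" using \<nu>s \<nu>s2 by (simp add: bessel_root_eq_iff_slope)
    show "\<mu> = \<nu>s" if "\<mu> > 2" "bessel_root_eq \<mu>" for \<mu>
      using that sign(2) by (simp add: bessel_root_eq_iff_slope)
    show "\<bar>\<nu>s - 3.077\<bar> < 0.005" using strict unfolding abs_less_iff by simp
    fix \<nu> :: real assume \<nu>: "\<nu> > 2"
    have deriv1: "0 \<le> (\<Sum>n. real (Suc n) * J3_coeff \<nu> n) \<longleftrightarrow> \<nu> \<ge> \<nu>s"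
    proof -
      have "(\<nu> - 1) * (\<nu> - 2) > 0" using \<nu> by (intro mult_pos_pos) auto
      thus ?thesis using sign(1)[OF \<nu>] unfolding suminf_deriv_coeff_eq_slope[OF \<nu>]
        by (auto simp: zero_le_divide_iff)
    qed
    show "(starlike_in_disk (normalized_bessel_J3 \<nu>) \<and>
        (\<forall>n\<ge>1. close_to_convex_in_disk ((deriv ^^ n) (normalized_bessel_J3 \<nu>)))) \<longleftrightarrow> \<nu> \<ge> \<nu>s"
    proof
      assume "starlike_in_disk (normalized_bessel_J3 \<nu>) \<and>
        (\<forall>n\<ge>1. close_to_convex_in_disk ((deriv ^^ n) (normalized_bessel_J3 \<nu>)))"
      thus "\<nu> \<ge> \<nu>s" using starlike_normalized_bessel_J3_imp_nonneg[OF \<nu>] deriv1 by blast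
    next
      assume "\<nu> \<ge> \<nu>s"
      hence "\<nu> \<ge> 3" "0 \<le> (\<Sum>n. real (Suc n) * J3_coeff \<nu> n)" using \<nu>s(1) deriv1 by auto
      thus "starlike_in_disk (normalized_bessel_J3 \<nu>) \<and>
        (\<forall>n\<ge>1. close_to_convex_in_disk ((deriv ^^ n) (normalized_bessel_J3 \<nu>)))"
        using starlike_in_disk_normalized_bessel_J3 close_to_convex_deriv_normalized_bessel_J3 by blast
    qed
  qed (use \<nu>s2 close_to_convex_imp_inj_on in auto)
qed

end
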